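(* For every sandpile graph $E$, the following lattices are isomorphic to each other: (1) the lattice $\mathrm{Idem}(\mathrm{SP}(E))$ of all idempotents of $\mathrm{SP}(E)$; (2) the lattice $\mathcal{F}_E$ of all filters of $\mathcal{C}_E$; (3) the lattice $\mathcal{H}_E$ of all nonempty saturated hereditary subsets of $E^0$; (4) the lattice $\mathrm{Ideal}(\mathcal{H}^s_E)$ of all ideals of $\mathcal{H}^s_E$; (5) the lattice $\mathcal{L}(\mathrm{SP}(E))$ of all order-ideals of $\mathrm{SP}(E)$.
   Context: Graphs are directed: $E=(E^0,E^1,s,r)$ with source and range maps $s,r:E^1\to E^0$. A sink is a vertex emitting no edges; a vertex is regular if it is not a sink and emits only finitely many edges; $E^0_{\mathrm{reg}}$ is the set of regular vertices. Vertices are paths of length $0$. A cycle is a closed path $e_1\cdots e_n$ ($n\ge 1$) with $s(e_i)\ne s(e_j)$ for $i\neq j$. A sandpile graph is a finite directed graph with a unique sink (also denoted $s$) such that from every vertex there is a path to $s$. Its sandpile monoid is the commutative monoid $$\mathrm{SP}(E)=\langle v\mid v\in E^0\rangle\big/\big\langle s=0;\ |s^{-1}(v)|\,v=\textstyle\sum_{e\in s^{-1}(v)}r(e)\ \text{for all } v\in E^0\setminus\{s\}\big\rangle,$$ the quotient of the free commutative monoid on $E^0$ by the congruence generated by these relations. For a commutative monoid $M$, put $x\le y$ iff $y=x+m$ for some $m\in M$. $\mathrm{Idem}(M)$ is the set of idempotents ($m+m=m$); for finite $M$, $(\mathrm{Idem}(M),\le)$ is a lattice with $m\vee m'=m+m'$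 and $m\wedge m'=\sum_{x\le m,m'}x$ (sum over idempotents $x$). An order-ideal of $M$ is a submonoid $I$ such that $x+y\in I$ implies $x,y\in I$; $\mathcal{L}(M)$ is the lattice of order-ideals under inclusion. $H\subseteq E^0$ is hereditary if $s(e)\in H$ implies $r(e)\in H$ for all $e\in E^1$; it is saturated if $v\in E^0_{\mathrm{reg}}$ and $r(s^{-1}(v))\subseteq H$ imply $v\in H$. $\overline{H}$ is the smallest hereditary saturated subset containing $H$. $\mathcal{H}_E$ is the set of all nonempty saturated hereditary subsets of $E^0$, a lattice under inclusion with $H\vee H'=\overline{H\cup H'}$, $H\wedge H'=H\cap H'$. For a partially ordered set $P$: an ideal is a nonempty subset $I$ such that $x\in I$, $y\le x$ imply $y\in I$; a filter is a (possibly empty) subset $F$ such that $x\in F$, $x\le y$ imply $y\in F$. $\mathcal{C}_E$ is the set of strongly connected cyclic components of $E$ (strongly connected components containing a cycle), partially ordered by $C\le C'$ iff there is a path from $C$ to $C'$. $\mathcal{F}_E$ is the set of filters of $\mathcal{C}_E$, a lattice under union and intersection. $S_E$ is the set of all vertices of $E$ which do not connect to (have no path to) any cycle in $E$. For $C\in\mathcal{C}_E$, $C^0$ is its set of vertices and $H_C=\overline{C^0}$. $\mathcal{H}^s_E=\{S_E\}\cup\{H_C\mid C\in\mathcal{C}_E\}$, partially ordered by inclusion (with smallest element $S_E$), and $\mathrm{Ideal}(\mathcal{H}^s_E)$ is the lattice of its ideals, ordered by inclusion. *)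

theory Defs
  imports
    "Graph_Theory.Graph_Theory"
    "HOL-Library.Multiset"
    "HOL-Algebra.Coset"
    "HOL-Algebra.Lattice"
begin

section \<open>Ordered sets and lattice isomorphisms\<close>

text \<open>
  Every order relation here has ordinary equality as its underlying equivalence.  Joins and
  meets of a lattice are the library's binary suprema and infima, which the order determines.
\<close>

definition inclusion_order :: "'a set set \<Rightarrow> 'a set gorder" where
  "inclusion_order A = \<lparr>carrier = A, eq = (=), le = (\<subseteq>)\<rparr>"

definition poset_ideal :: "('a, 'b) gorder_scheme \<Rightarrow> 'a set \<Rightarrow> bool" where
  "poset_ideal P I \<longleftrightarrow>
     I \<subseteq> carrier P \<and> I \<noteq> {} \<and> (\<forall>x\<in>I. \<forall>y\<in>carrier P. y \<sqsubseteq>\<^bsub>P\<^esub> x \<longrightarrow> y \<in> I)"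

definition poset_filter :: "('a, 'b) gorder_scheme \<Rightarrow> 'a set \<Rightarrow> bool" where
  "poset_filter P F \<longleftrightarrow>
     F \<subseteq> carrier P \<and> (\<forall>x\<in>F. \<forall>y\<in>carrier P. x \<sqsubseteq>\<^bsub>P\<^esub> y \<longrightarrow> y \<in> F)"

text \<open>
  Note that \<^const>\<open>join_pres\<close> and \<^const>\<open>meet_pres\<close> both include that the two structures
  are lattices.
\<close>

definition lattice_isomorphic ::
    "('a, 'c) gorder_scheme \<Rightarrow> ('b, 'd) gorder_scheme \<Rightarrow> bool" where
  "lattice_isomorphic L M \<longleftrightarrow>
     (\<exists>f. bij_betw f (carrier L) (carrier M) \<and> join_pres L M f \<and> meet_pres L M f)"


section \<open>Commutative monoids\<close>

text \<open>
  Commutative monoids are written with the multiplicative record of \<open>HOL-Algebra\<close>: its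
  product and unit play the roles of addition and zero.
\<close>

definition free_comm_monoid :: "'a set \<Rightarrow> 'a multiset monoid" where
  "free_comm_monoid X = \<lparr>carrier = {A. set_mset A \<subseteq> X}, mult = (+), one = {#}\<rparr>"

definition monoid_congruence :: "('a, 'b) monoid_scheme \<Rightarrow> ('a \<times> 'a) set \<Rightarrow> bool" where
  "monoid_congruence M r \<longleftrightarrow>
     equiv (carrier M) r \<and>
     (\<forall>a b c d. (a, b) \<in> r \<and> (c, d) \<in> r \<longrightarrow> (a \<otimes>\<^bsub>M\<^esub> c, b \<otimes>\<^bsub>M\<^esub> d) \<in> r)"

text \<open>
  The elementwise product of two congruence classes need not be a whole class; the product in
  the quotient is the class that contains it.
\<close>

definition quotient_monoid ::
    "('a, 'b) monoid_scheme \<Rightarrow> ('a \<times> 'a) set \<Rightarrow> 'a set monoid" where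
  "quotient_monoid M r =
     \<lparr>carrier = carrier M // r,
      mult = (\<lambda>A B. r `` (A <#>\<^bsub>M\<^esub> B)),
      one = r `` {\<one>\<^bsub>M\<^esub>}\<rparr>"

definition presented_comm_monoid ::
    "'a set \<Rightarrow> ('a multiset \<times> 'a multiset) set \<Rightarrow> 'a multiset set monoid" where
  "presented_comm_monoid X R =
     quotient_monoid (free_comm_monoid X) (monoid_congruence (free_comm_monoid X) hull R)"

definition monoid_le :: "('a, 'b) monoid_scheme \<Rightarrow> 'a \<Rightarrow> 'a \<Rightarrow> bool" where
  "monoid_le M x y \<longleftrightarrow> (\<exists>m\<in>carrier M. y = x \<otimes>\<^bsub>M\<^esub> m)"

definition Idem_lattice :: "('a, 'b) monoid_scheme \<Rightarrow> 'a gorder" where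
  "Idem_lattice M =
     \<lparr>carrier = {m \<in> carrier M. m \<otimes>\<^bsub>M\<^esub> m = m}, eq = (=), le = monoid_le M\<rparr>"

definition order_ideal :: "('a, 'b) monoid_scheme \<Rightarrow> 'a set \<Rightarrow> bool" where
  "order_ideal M I \<longleftrightarrow>
     submonoid I M \<and>
     (\<forall>x\<in>carrier M. \<forall>y\<in>carrier M. x \<otimes>\<^bsub>M\<^esub> y \<in> I \<longrightarrow> x \<in> I \<and> y \<in> I)"

definition order_ideal_lattice :: "('a, 'b) monoid_scheme \<Rightarrow> 'a set gorder" where
  "order_ideal_lattice M = inclusion_order {I. order_ideal M I}"


section \<open>Sandpile graphs and sandpile monoids\<close>

text \<open>Loops and parallel edges are allowed.\<close>

definition is_sink :: "('v, 'e) pre_digraph \<Rightarrow> 'v \<Rightarrow> bool" where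
  "is_sink E v \<longleftrightarrow> v \<in> verts E \<and> out_arcs E v = {}"

locale sandpile_graph = fin_digraph E for E :: "('v, 'e) pre_digraph" +
  fixes s :: 'v
  assumes is_sink_iff: "is_sink E v \<longleftrightarrow> v = s"
    and reaches_sink: "v \<in> verts E \<Longrightarrow> v \<rightarrow>\<^sup>*\<^bsub>E\<^esub> s"

text \<open>
  The sum of the ranges of the edges leaving a vertex is an image of a multiset, so parallel
  edges contribute with their multiplicity.
\<close>

definition sandpile_relations ::
    "('v, 'e) pre_digraph \<Rightarrow> 'v \<Rightarrow> ('v multiset \<times> 'v multiset) set" where
  "sandpile_relations E s =
     insert ({#s#}, {#})
       {(replicate_mset (out_degree E v) v, image_mset (head E) (mset_set (out_arcs E v))) | v.
          v \<in> verts E - {s}}"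

definition SP :: "('v, 'e) pre_digraph \<Rightarrow> 'v \<Rightarrow> 'v multiset set monoid" where
  "SP E s = presented_comm_monoid (verts E) (sandpile_relations E s)"


section \<open>Hereditary saturated sets\<close>

definition regular_vertex :: "('v, 'e) pre_digraph \<Rightarrow> 'v \<Rightarrow> bool" where
  "regular_vertex E v \<longleftrightarrow> v \<in> verts E \<and> \<not> is_sink E v \<and> finite (out_arcs E v)"

definition hereditary :: "('v, 'e) pre_digraph \<Rightarrow> 'v set \<Rightarrow> bool" where
  "hereditary E H \<longleftrightarrow> H \<subseteq> verts E \<and> (\<forall>e\<in>arcs E. tail E e \<in> H \<longrightarrow> head E e \<in> H)"

definition saturated :: "('v, 'e) pre_digraph \<Rightarrow> 'v set \<Rightarrow> bool" where
  "saturated E H \<longleftrightarrow>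
     H \<subseteq> verts E \<and> (\<forall>v. regular_vertex E v \<and> head E ` out_arcs E v \<subseteq> H \<longrightarrow> v \<in> H)"

definition hereditary_saturated_closure :: "('v, 'e) pre_digraph \<Rightarrow> 'v set \<Rightarrow> 'v set" where
  "hereditary_saturated_closure E H = (\<lambda>K. hereditary E K \<and> saturated E K) hull H"

definition hereditary_saturated_lattice :: "('v, 'e) pre_digraph \<Rightarrow> 'v set gorder" where
  "hereditary_saturated_lattice E =
     inclusion_order {H. H \<noteq> {} \<and> hereditary E H \<and> saturated E H}"


section \<open>Strongly connected cyclic components\<close>

text \<open>
  The library's strongly connected components are induced subgraphs, and its cycles are the
  closed walks of positive length that visit no vertex twice; a loop is a cycle.
\<close>

definition cyclic_components :: "('v, 'e) pre_digraph \<Rightarrow> ('v, 'e) pre_digraph set" where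
  "cyclic_components E = {C \<in> pre_digraph.sccs E. \<exists>p. pre_digraph.cycle C p}"

definition cyclic_component_order :: "('v, 'e) pre_digraph \<Rightarrow> ('v, 'e) pre_digraph gorder" where
  "cyclic_component_order E =
     \<lparr>carrier = cyclic_components E, eq = (=),
      le = (\<lambda>C C'. \<exists>u\<in>verts C. \<exists>v\<in>verts C'. u \<rightarrow>\<^sup>*\<^bsub>E\<^esub> v)\<rparr>"

definition filter_lattice :: "('v, 'e) pre_digraph \<Rightarrow> ('v, 'e) pre_digraph set gorder" where
  "filter_lattice E = inclusion_order {F. poset_filter (cyclic_component_order E) F}"

definition acyclic_part :: "('v, 'e) pre_digraph \<Rightarrow> 'v set" where
  "acyclic_part E =
     {v \<in> verts E. \<not> (\<exists>p. pre_digraph.cycle E p \<and> (\<exists>e\<in>set p. v \<rightarrow>\<^sup>*\<^bsub>E\<^esub> tail E e))}"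

text \<open>
  The acyclic part (written $S_E$ in the literature) is the least element of the next poset;
  the other elements are the closures $H_C$ of the vertex sets of the cyclic components.
\<close>

definition Hs_order :: "('v, 'e) pre_digraph \<Rightarrow> 'v set gorder" where
  "Hs_order E =
     inclusion_order
       (insert (acyclic_part E)
         ((\<lambda>C. hereditary_saturated_closure E (verts C)) ` cyclic_components E))"

definition Hs_ideal_lattice :: "('v, 'e) pre_digraph \<Rightarrow> 'v set set gorder" where
  "Hs_ideal_lattice E = inclusion_order {I. poset_ideal (Hs_order E) I}"

end

theory Submission
  imports Defs
begin

text \<open>
  A filter \<open>F\<close> of cyclic components corresponds to the set of all vertices from which only cyclic
  components in \<open>F\<close> can be reached.  Every nonempty hereditary saturated set \<open>H\<close> arises in this
  way: it contains the sink, so a vertex outside \<open>H\<close> always has an edge to another vertex outside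
  \<open>H\<close>, and by finiteness it reaches a cycle outside \<open>H\<close>.  The closure of a cyclic component is the
  set belonging to its principal filter, so ideals of these closures are filters again.

  An order-ideal of the sandpile monoid is determined by the vertices whose classes it contains,
  and \<open>supp A \<subseteq> H\<close> is invariant under the defining relations exactly when \<open>H\<close> is
  hereditary, saturated and contains the sink.  Finally, stabilisation shows that the sandpile
  monoid is finite, and in a finite commutative monoid every order-ideal is the set of elements
  below a unique idempotent, namely a suitable power of an upper bound of the ideal.
\<close>

section \<open>Order isomorphisms\<close>

text \<open>Stated as a bijective order embedding because this form inverts and composes for
  arbitrary orders. Preservation of joins and meets is derived once, for all pairs.\<close>

definition order_isomorphism ::
    "('a, 'c) gorder_scheme \<Rightarrow> ('b, 'd) gorder_scheme \<Rightarrow> ('a \<Rightarrow> 'b) \<Rightarrow> bool" where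
  "order_isomorphism L M f \<longleftrightarrow>
     bij_betw f (carrier L) (carrier M) \<and>
     (\<forall>x\<in>carrier L. \<forall>y\<in>carrier L. f x \<sqsubseteq>\<^bsub>M\<^esub> f y \<longleftrightarrow> x \<sqsubseteq>\<^bsub>L\<^esub> y)"

definition order_isomorphic :: "('a, 'c) gorder_scheme \<Rightarrow> ('b, 'd) gorder_scheme \<Rightarrow> bool" where
  "order_isomorphic L M \<longleftrightarrow> (\<exists>f. order_isomorphism L M f)"

text \<open>Injectivity is a consequence: if \<open>f x = f y\<close>, reflexivity at
  \<open>x\<close> and at \<open>y\<close> together with the embedding property gives both
  \<open>x \<sqsubseteq> y\<close> and \<open>y \<sqsubseteq> x\<close>, and antisymmetry
  applies.\<close>

lemma order_isomorphicI:
  assumes "f ` carrier L = carrier M"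
    and "\<And>x y. x \<in> carrier L \<Longrightarrow> y \<in> carrier L \<Longrightarrow> f x \<sqsubseteq>\<^bsub>M\<^esub> f y \<longleftrightarrow> x \<sqsubseteq>\<^bsub>L\<^esub> y"
    and "\<And>x. x \<in> carrier L \<Longrightarrow> x \<sqsubseteq>\<^bsub>L\<^esub> x"
    and "\<And>x y. x \<in> carrier L \<Longrightarrow> y \<in> carrier L \<Longrightarrow> x \<sqsubseteq>\<^bsub>L\<^esub> y \<Longrightarrow> y \<sqsubseteq>\<^bsub>L\<^esub> x \<Longrightarrow> x = y"
  shows "order_isomorphic L M"
proof -
  have "inj_on f (carrier L)"
    using assms(2-4) by (metis inj_onI)
  then show ?thesis
    using assms(1,2) by (auto simp: order_isomorphic_def order_isomorphism_def bij_betw_def)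
qed

lemma order_isomorphism_inv:
  assumes "order_isomorphism L M f"
  shows "order_isomorphism M L (inv_into (carrier L) f)"
  unfolding order_isomorphism_def
proof (intro conjI ballI)
  have f: "bij_betw f (carrier L) (carrier M)"
    using assms by (simp add: order_isomorphism_def)
  then show "bij_betw (inv_into (carrier L) f) (carrier M) (carrier L)"
    by (rule bij_betw_inv_into)
  fix x y assume xy: "x \<in> carrier M" "y \<in> carrier M"
  then have "inv_into (carrier L) f x \<in> carrier L" "inv_into (carrier L) f y \<in> carrier L"
    using f bij_betw_inv_into bij_betwE by blast+
  then show "inv_into (carrier L) f x \<sqsubseteq>\<^bsub>L\<^esub> inv_into (carrier L) f y \<longleftrightarrow> x \<sqsubseteq>\<^bsub>M\<^esub> y"
    using assms bij_betw_inv_into_right[OF f xy(1)] bij_betw_inv_into_right[OF f xy(2)]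
    unfolding order_isomorphism_def by metis
qed

lemma order_isomorphic_sym: "order_isomorphic L M \<Longrightarrow> order_isomorphic M L"
  unfolding order_isomorphic_def using order_isomorphism_inv by blast

lemma order_isomorphic_trans:
  assumes "order_isomorphic L M" "order_isomorphic M N"
  shows "order_isomorphic L N"
proof -
  obtain f g where "order_isomorphism L M f" "order_isomorphism M N g"
    using assms by (auto simp: order_isomorphic_def)
  then have "order_isomorphism L N (g \<circ> f)"
    unfolding order_isomorphism_def by (auto simp: bij_betw_trans dest: bij_betwE)
  then show ?thesis
    by (auto simp: order_isomorphic_def)
qed

section \<open>Transport of suprema, infima and the lattice property\<close>

lemma least_Upper_order_isomorphism:
  assumes "order_isomorphism L M f" "x \<in> carrier L" "A \<subseteq> carrier L"
  shows "least M (f x) (Upper M (f ` A)) \<longleftrightarrow> least L x (Upper L A)"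
proof -
  have surj: "carrier M = f ` carrier L"
    using assms(1) by (auto simp: order_isomorphism_def bij_betw_def)
  have emb: "f a \<sqsubseteq>\<^bsub>M\<^esub> f b \<longleftrightarrow> a \<sqsubseteq>\<^bsub>L\<^esub> b" if "a \<in> carrier L" "b \<in> carrier L" for a b
    using assms(1) that by (auto simp: order_isomorphism_def)
  have mem: "u \<in> Upper L A \<longleftrightarrow> (\<forall>a\<in>A. f a \<sqsubseteq>\<^bsub>M\<^esub> f u)" if "u \<in> carrier L" for u
    using emb[OF _ that] assms(3) that by (auto simp: Upper_def)
  \<comment> \<open>By surjectivity every candidate bound in \<open>M\<close> is some
    \<open>f u\<close>, so the upper bounds of the image are the images of the upper bounds.\<close>
  have "Upper M (f ` A) = f ` {u \<in> carrier L. \<forall>a\<in>A. f a \<sqsubseteq>\<^bsub>M\<^esub> f u}"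
    using assms(3) by (auto simp: Upper_def surj)
  also have "{u \<in> carrier L. \<forall>a\<in>A. f a \<sqsubseteq>\<^bsub>M\<^esub> f u} = Upper L A"
    using mem by (auto simp: Upper_def)
  finally have "least M (f x) (Upper M (f ` A)) \<longleftrightarrow> f x \<in> f ` Upper L A \<and> (\<forall>u\<in>Upper L A. f x \<sqsubseteq>\<^bsub>M\<^esub> f u)"
    by (auto simp: least_def surj Upper_def)
  also have "f x \<in> f ` Upper L A \<longleftrightarrow> x \<in> Upper L A"
    using assms by (intro inj_on_image_mem_iff[of _ "carrier L"])
      (auto simp: order_isomorphism_def bij_betw_def Upper_def)
  finally show ?thesis
    using assms(2) emb by (auto simp: least_def Upper_def)
qed

text \<open>Duality: infima are suprema of the inverse order, so the next lemma follows from the one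
  on suprema.\<close>

lemma order_isomorphism_inv_gorder:
  "order_isomorphism (inv_gorder L) (inv_gorder M) f \<longleftrightarrow> order_isomorphism L M f"
  by (auto simp: order_isomorphism_def)

lemma greatest_Lower_order_isomorphism:
  assumes "order_isomorphism L M f" "x \<in> carrier L" "A \<subseteq> carrier L"
  shows "greatest M (f x) (Lower M (f ` A)) \<longleftrightarrow> greatest L x (Lower L A)"
  using least_Upper_order_isomorphism[of "inv_gorder L" "inv_gorder M" f x A] assms
  by (simp add: order_isomorphism_inv_gorder)

text \<open>An order isomorphism says nothing about the equivalence stored in a
  \<open>gorder\<close>. The hypothesis on \<open>eq M\<close> fixes it, so that antisymmetry in
  \<open>M\<close> refers to equality and can be pulled back to \<open>L\<close>.\<close>

lemma lattice_order_isomorphism: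
  assumes f: "order_isomorphism L M f" and "lattice L" and eq: "eq M = (=)"
  shows "lattice M"
proof -
  interpret L: lattice L by fact
  have surj: "carrier M = f ` carrier L"
    using f by (auto simp: order_isomorphism_def bij_betw_def)
  have emb: "f a \<sqsubseteq>\<^bsub>M\<^esub> f b \<longleftrightarrow> a \<sqsubseteq>\<^bsub>L\<^esub> b" if "a \<in> carrier L" "b \<in> carrier L" for a b
    using f that by (auto simp: order_isomorphism_def)
  show ?thesis
  proof (unfold_locales, simp_all add: eq)
    show "x \<sqsubseteq>\<^bsub>M\<^esub> x" if "x \<in> carrier M" for x
      using that emb by (auto simp: surj)
    show "x = y" if "x \<sqsubseteq>\<^bsub>M\<^esub> y" "y \<sqsubseteq>\<^bsub>M\<^esub> x" "x \<in> carrier M" "y \<in> carrier M" for x y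
      using that emb L.le_antisym by (auto simp: surj) metis
    show "x \<sqsubseteq>\<^bsub>M\<^esub> z"
      if "x \<sqsubseteq>\<^bsub>M\<^esub> y" "y \<sqsubseteq>\<^bsub>M\<^esub> z" "x \<in> carrier M" "y \<in> carrier M" "z \<in> carrier M" for x y z
      using that emb L.le_trans by (auto simp: surj)
    fix x y assume "x \<in> carrier M" "y \<in> carrier M"
    then obtain a b where ab: "a \<in> carrier L" "b \<in> carrier L" "x = f a" "y = f b"
      by (auto simp: surj)
    obtain u where "least L u (Upper L {a, b})" "u \<in> carrier L"
      using L.sup_of_two_exists[OF ab(1,2)] by (auto simp: least_def Upper_def)
    then show "\<exists>u. least M u (Upper M {x, y})"
      using least_Upper_order_isomorphism[OF f, of u "{a, b}"] ab by auto
    obtain l where "greatest L l (Lower L {a, b})" "l \<in> carrier L"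
      using L.inf_of_two_exists[OF ab(1,2)] by (auto simp: greatest_def Lower_def)
    then show "\<exists>l. greatest M l (Lower M {x, y})"
      using greatest_Lower_order_isomorphism[OF f, of l "{a, b}"] ab by auto
  qed
qed

lemma order_isomorphism_imp_lattice_isomorphic:
  assumes f: "order_isomorphism L M f" and "lattice L" "lattice M"
  shows "lattice_isomorphic L M"
proof -
  interpret L: lattice L by fact
  interpret M: lattice M by fact
  have bij: "bij_betw f (carrier L) (carrier M)"
    using f by (auto simp: order_isomorphism_def)
  have "f (a \<squnion>\<^bsub>L\<^esub> b) = f a \<squnion>\<^bsub>M\<^esub> f b" if ab: "a \<in> carrier L" "b \<in> carrier L" for a b
  proof (rule M.joinI)
    fix l assume l: "least M l (Upper M {f a, f b})"
    have "least L (a \<squnion>\<^bsub>L\<^esub> b) (Upper L {a, b})"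
      by (rule L.joinI) (use ab in auto)
    then have "least M (f (a \<squnion>\<^bsub>L\<^esub> b)) (Upper M {f a, f b})"
      using least_Upper_order_isomorphism[OF f, of "a \<squnion>\<^bsub>L\<^esub> b" "{a, b}"] ab by simp
    then show "f (a \<squnion>\<^bsub>L\<^esub> b) = l"
      using l by (rule M.least_unique)
  qed (use ab bij in \<open>auto dest: bij_betwE\<close>)
  moreover have "f (a \<sqinter>\<^bsub>L\<^esub> b) = f a \<sqinter>\<^bsub>M\<^esub> f b" if ab: "a \<in> carrier L" "b \<in> carrier L" for a b
  proof (rule M.meetI)
    fix l assume l: "greatest M l (Lower M {f a, f b})"
    have "greatest L (a \<sqinter>\<^bsub>L\<^esub> b) (Lower L {a, b})"
      by (rule L.meetI) (use ab in auto)
    then have "greatest M (f (a \<sqinter>\<^bsub>L\<^esub> b)) (Lower M {f a, f b})"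
      using greatest_Lower_order_isomorphism[OF f, of "a \<sqinter>\<^bsub>L\<^esub> b" "{a, b}"] ab by simp
    then show "f (a \<sqinter>\<^bsub>L\<^esub> b) = l"
      using l by (rule M.greatest_unique)
  qed (use ab bij in \<open>auto dest: bij_betwE\<close>)
  ultimately show ?thesis
    using bij assms by (auto simp: lattice_isomorphic_def join_pres_def meet_pres_def)
qed

text \<open>Here \<open>N\<close> is a hub: it alone has to be shown a lattice, and all pairs are
  compared through it.\<close>

lemma order_isomorphic_imp_lattice_isomorphic:
  assumes "order_isomorphic N L" "order_isomorphic N M"
    and "lattice N" "eq L = (=)" "eq M = (=)"
  shows "lattice_isomorphic L M"
proof -
  have "lattice L" "lattice M"
    using assms lattice_order_isomorphism unfolding order_isomorphic_def by blast+
  moreover have "order_isomorphic L M"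
    using assms order_isomorphic_sym order_isomorphic_trans by blast
  ultimately show ?thesis
    using order_isomorphism_imp_lattice_isomorphic unfolding order_isomorphic_def by blast
qed

lemma inclusion_order_simps [simp]:
  "carrier (inclusion_order A) = A"
  "eq (inclusion_order A) = (=)"
  "le (inclusion_order A) = (\<subseteq>)"
  by (simp_all add: inclusion_order_def)

lemma lattice_inclusion_order:
  assumes "\<And>X Y. X \<in> A \<Longrightarrow> Y \<in> A \<Longrightarrow> X \<union> Y \<in> A"
    and "\<And>X Y. X \<in> A \<Longrightarrow> Y \<in> A \<Longrightarrow> X \<inter> Y \<in> A"
  shows "lattice (inclusion_order A)"
proof (unfold_locales, simp_all)
  fix X Y assume "X \<in> A" "Y \<in> A"
  then have "least (inclusion_order A) (X \<union> Y) (Upper (inclusion_order A) {X, Y})"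
    "greatest (inclusion_order A) (X \<inter> Y) (Lower (inclusion_order A) {X, Y})"
    using assms by (auto simp: least_def greatest_def Upper_def Lower_def)
  then show "\<exists>U. least (inclusion_order A) U (Upper (inclusion_order A) {X, Y})"
    "\<exists>L. greatest (inclusion_order A) L (Lower (inclusion_order A) {X, Y})"
    by blast+
qed

section \<open>Idempotents and order-ideals of finite commutative monoids\<close>

lemma (in comm_monoid) monoid_le_trans:
  assumes "monoid_le G x y" "monoid_le G y z" "x \<in> carrier G"
  shows "monoid_le G x z"
  using assms by (auto simp: monoid_le_def) (metis m_assoc m_closed)

lemma (in comm_monoid) monoid_le_mult:
  assumes "x \<in> carrier G" "y \<in> carrier G"
  shows "monoid_le G x (x \<otimes> y)" "monoid_le G y (x \<otimes> y)"
  using assms m_comm by (auto simp: monoid_le_def)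

text \<open>If \<open>e = x \<otimes> m\<close>, a further factor \<open>x\<close> is absorbed by
  idempotence; conversely \<open>e\<close> is its own witness. On idempotents the relation becomes
  an equation, and antisymmetry reduces to commutativity.\<close>

lemma (in comm_monoid) monoid_le_idempotent_iff:
  assumes "x \<in> carrier G" "e \<in> carrier G" "x \<otimes> x = x"
  shows "monoid_le G x e \<longleftrightarrow> x \<otimes> e = e"
  using assms by (metis m_assoc monoid_le_def)

lemma (in comm_monoid) idempotent_ideal:
  assumes e: "e \<in> carrier G" "e \<otimes> e = e"
  shows "order_ideal G {x \<in> carrier G. monoid_le G x e}"
proof -
  have "monoid_le G (x \<otimes> y) e"
    if "x \<in> carrier G" "y \<in> carrier G" and le: "monoid_le G x e" "monoid_le G y e" for x y
  proof -
    obtain m n where mn: "m \<in> carrier G" "n \<in> carrier G" "e = x \<otimes> m" "e = y \<otimes> n"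
      using le by (auto simp: monoid_le_def)
    \<comment> \<open>Idempotence provides a second copy of \<open>e\<close>, so each factor can be
      completed to \<open>e\<close> separately.\<close>
    then have "e = (x \<otimes> m) \<otimes> (y \<otimes> n)"
      using e by metis
    also have "\<dots> = (x \<otimes> y) \<otimes> (m \<otimes> n)"
      using mn that by (simp add: m_ac)
    finally show ?thesis
      using mn by (auto simp: monoid_le_def)
  qed
  moreover have "monoid_le G \<one> e"
    using e by (auto simp: monoid_le_def)
  moreover have "monoid_le G x e \<and> monoid_le G y e"
    if "x \<in> carrier G" "y \<in> carrier G" "monoid_le G (x \<otimes> y) e" for x y
    using that monoid_le_mult[of x y] monoid_le_trans[of _ "x \<otimes> y" e] by blast
  ultimately show ?thesis
    unfolding order_ideal_def submonoid_def by blast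
qed

text \<open>Finiteness makes the powers of \<open>x\<close> periodic with some period
  \<open>p\<close> from some exponent \<open>i\<close> on. The exponent \<open>i * p\<close> is both
  at least \<open>i\<close> and a multiple of \<open>p\<close>, so doubling it does not change the
  power.\<close>

lemma (in comm_monoid) idempotent_power:
  assumes "finite (carrier G)" "x \<in> carrier G"
  obtains n where "0 < n" "x [^] (n :: nat) \<otimes> x [^] n = x [^] n"
proof -
  \<comment> \<open>Starting at 1 makes \<open>i\<close> positive, hence also the exponent
    \<open>i * p\<close>; exponent 0 would only give the unit.\<close>
  have "\<not> inj_on (\<lambda>n :: nat. x [^] n) {1..}"
    using assms by (auto dest!: finite_imageD[rotated] intro: finite_subset[of _ "carrier G"] simp: infinite_Ici)
  then obtain i j where ij: "x [^] i = x [^] j" "0 < i" "i < (j :: nat)"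
    unfolding inj_on_def by (metis atLeast_iff less_eq_Suc_le One_nat_def linorder_neqE_nat)
  define p where "p = j - i"
  have p: "0 < p" "j = i + p"
    using ij by (auto simp: p_def)
  have step: "x [^] (n + p) = x [^] n" if "i \<le> n" for n
  proof -
    have "x [^] (n + p) = x [^] (n - i) \<otimes> x [^] j"
      using that p assms by (simp add: nat_pow_mult)
    then show ?thesis
      using that assms by (simp add: ij(1)[symmetric] nat_pow_mult)
  qed
  have "x [^] (n + k * p) = x [^] n" if "i \<le> n" for n k
  proof (induction k)
    case (Suc k)
    have "x [^] (n + Suc k * p) = x [^] ((n + k * p) + p)"
      by (simp add: algebra_simps)
    then show ?case
      using Suc step[of "n + k * p"] that by simp
  qed simp
  from this[of "i * p" i] have "x [^] (i * p) \<otimes> x [^] (i * p) = x [^] (i * p)"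
    using p assms by (simp add: nat_pow_mult)
  then show thesis
    using ij(2) p(1) that[of "i * p"] by simp
qed

lemma (in comm_monoid) submonoid_finite_upper_bound:
  assumes "submonoid I G" "finite J" "J \<subseteq> I"
  shows "\<exists>z\<in>I. \<forall>x\<in>J. monoid_le G x z"
  using assms(2,3)
proof (induction J)
  case empty
  then show ?case
    using submonoid.one_closed[OF assms(1)] by blast
next
  case (insert y J)
  then obtain z where z: "z \<in> I" "\<forall>x\<in>J. monoid_le G x z"
    by auto
  have "y \<in> carrier G" "z \<in> carrier G" "J \<subseteq> carrier G"
    using insert.prems z(1) submonoid.subset[OF assms(1)] by auto
  then have "\<forall>x\<in>insert y J. monoid_le G x (y \<otimes> z)"
    using z(2) monoid_le_mult[of y z] monoid_le_trans[of _ z "y \<otimes> z"] by blast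
  moreover have "y \<otimes> z \<in> I"
    using insert.prems z(1) submonoid.m_closed[OF assms(1)] by auto
  ultimately show ?case by blast
qed

lemma (in comm_monoid) order_ideal_principal:
  assumes fin: "finite (carrier G)" and I: "order_ideal G I"
  obtains e where "e \<in> carrier G" "e \<otimes> e = e" "I = {x \<in> carrier G. monoid_le G x e}"
proof -
  interpret I: submonoid I G
    using I by (simp add: order_ideal_def)
  obtain z where z: "z \<in> I" "\<forall>x\<in>I. monoid_le G x z"
    using submonoid_finite_upper_bound[OF I.is_submonoid, of I] finite_subset[OF I.subset fin]
    by blast
  have zc: "z \<in> carrier G"
    using z I.subset by auto
  obtain n where n: "0 < n" "z [^] (n :: nat) \<otimes> z [^] n = z [^] n"
    using idempotent_power[OF fin zc] by blast
  have "z [^] k \<in> I" for k :: nat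
    by (induction k) (auto simp: z(1))
  \<comment> \<open>Positivity of \<open>n\<close> lets one factor \<open>z\<close> be split off; so
    the idempotent still bounds the whole ideal.\<close>
  moreover have "monoid_le G z (z [^] n)"
    using n(1) zc monoid_le_mult(2)[of "z [^] (n - 1)" z] by (cases n) auto
  \<comment> \<open>Closure under factors makes \<open>I\<close> downward closed, which gives the
    reverse inclusion.\<close>
  moreover have "x \<in> I" if "x \<in> carrier G" "monoid_le G x y" "y \<in> I" for x y
    using that I I.subset unfolding order_ideal_def monoid_le_def by blast
  ultimately have "I = {x \<in> carrier G. monoid_le G x (z [^] n)}"
    using I.subset z(2) monoid_le_trans[of _ z "z [^] n"] by blast
  with nat_pow_closed[OF zc] n(2) show thesis
    by (rule that)
qed

lemma Idem_lattice_order_isomorphic: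
  assumes "comm_monoid M" "finite (carrier M)"
  shows "order_isomorphic (Idem_lattice M) (order_ideal_lattice M)"
proof -
  interpret comm_monoid M by fact
  show ?thesis
  proof (rule order_isomorphicI[where f = "\<lambda>e. {x \<in> carrier M. monoid_le M x e}"])
    show "(\<lambda>e. {x \<in> carrier M. monoid_le M x e}) ` carrier (Idem_lattice M)
        = carrier (order_ideal_lattice M)"
    proof (intro subset_antisym subsetI)
      fix I assume "I \<in> carrier (order_ideal_lattice M)"
      then have "order_ideal M I"
        by (simp add: order_ideal_lattice_def)
      from order_ideal_principal[OF assms(2) this]
      show "I \<in> (\<lambda>e. {x \<in> carrier M. monoid_le M x e}) ` carrier (Idem_lattice M)"
        by (auto simp: Idem_lattice_def)
    qed (auto simp: Idem_lattice_def order_ideal_lattice_def idempotent_ideal)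
    show refl: "e \<sqsubseteq>\<^bsub>Idem_lattice M\<^esub> e" if "e \<in> carrier (Idem_lattice M)" for e
      using that by (simp add: Idem_lattice_def monoid_le_idempotent_iff)
    show "{x \<in> carrier M. monoid_le M x e} \<sqsubseteq>\<^bsub>order_ideal_lattice M\<^esub> {x \<in> carrier M. monoid_le M x f}
        \<longleftrightarrow> e \<sqsubseteq>\<^bsub>Idem_lattice M\<^esub> f"
      if "e \<in> carrier (Idem_lattice M)" "f \<in> carrier (Idem_lattice M)" for e f
      \<comment> \<open>An idempotent lies in its own down-set, so nested down-sets give
        \<open>e\<close> below \<open>f\<close>; transitivity is the converse.\<close>
      using that refl[of e] monoid_le_trans[of _ e f] by (auto simp: Idem_lattice_def order_ideal_lattice_def)
    show "e = f" if "e \<in> carrier (Idem_lattice M)" "f \<in> carrier (Idem_lattice M)"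
        "e \<sqsubseteq>\<^bsub>Idem_lattice M\<^esub> f" "f \<sqsubseteq>\<^bsub>Idem_lattice M\<^esub> e" for e f
      using that by (auto simp: Idem_lattice_def monoid_le_idempotent_iff) (metis m_comm)
  qed
qed

section \<open>Cyclic components and hereditary saturated sets\<close>

lemma (in wf_digraph) hereditary_reachable:
  assumes "hereditary G H" "v \<rightarrow>\<^sup>* w" "v \<in> H"
  shows "w \<in> H"
  using assms(2,3)
proof (induction rule: converse_reachable_induct)
  case (step x y)
  then show ?case
    using assms(1) by (auto simp: hereditary_def arcs_ends_conv)
qed

text \<open>Replaces cycles as arc lists by vertices with \<open>v \<rightarrow>\<^sup>+ v\<close>,
  called recurrent below. A cycle yields such a vertex, and a nonempty closed walk inside a
  component contains a cycle.\<close>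

lemma (in wf_digraph) cyclic_components_conv:
  "cyclic_components G = (\<lambda>v. G \<restriction> scc_of v) ` {v. v \<rightarrow>\<^sup>+ v}"
proof (intro subset_antisym subsetI)
  fix C assume "C \<in> cyclic_components G"
  then obtain p where C: "C \<in> sccs" "pre_digraph.cycle C p"
    by (auto simp: cyclic_components_def)
  then have sub: "subgraph C G"
    by (auto simp: sccs_def)
  then interpret C: wf_digraph C
    by auto
  obtain u where u: "C.awalk u p u" "p \<noteq> []"
    using C(2) by (auto simp: C.cycle_def)
  then have "(u, u) \<in> (arcs_ends C)\<^sup>+" and uC: "u \<in> verts C"
    using C.reachable1_awalk by auto
  moreover have "arcs_ends C \<subseteq> arcs_ends G"
    using sub by (auto simp: subgraph_def compatible_def arcs_ends_conv)
  ultimately have "u \<rightarrow>\<^sup>+ u"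
    using trancl_mono by blast
  moreover have "verts C \<in> sccs_verts"
    using C(1) by (auto simp: sccs_verts_conv)
  then have "verts C = scc_of u"
    using uC scc_of_eq by (auto simp: sccs_verts_conv_scc_of)
  \<comment> \<open>A strong component is determined by its vertex set, so equal vertex sets
    suffice.\<close>
  then have "C = G \<restriction> scc_of u"
    using C(1) \<open>verts C \<in> sccs_verts\<close> inj_on_verts_sccs
    by (metis in_sccs_verts_conv induce_subgraph_verts inj_onD)
  ultimately show "C \<in> (\<lambda>v. G \<restriction> scc_of v) ` {v. v \<rightarrow>\<^sup>+ v}"
    by blast
next
  fix C assume "C \<in> (\<lambda>v. G \<restriction> scc_of v) ` {v. v \<rightarrow>\<^sup>+ v}"
  then obtain v where v: "v \<rightarrow>\<^sup>+ v" and C: "C = G \<restriction> scc_of v"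
    by auto
  have vG: "v \<in> verts G"
    using v reachable1_in_verts by blast
  then have scc: "C \<in> sccs"
    by (simp add: C in_sccs_verts_conv[symmetric] scc_of_in_sccs_verts)
  then have sc: "strongly_connected C" and "wf_digraph C"
    by (auto simp: sccs_def subgraph_def induced_subgraph_def)
  then interpret C: wf_digraph C
    by simp
  \<comment> \<open>The first edge of a closed walk at \<open>v\<close> ends in the component of
    \<open>v\<close>. The edge survives in the induced subgraph, and strong connectivity of
    \<open>C\<close> leads back to \<open>v\<close> inside \<open>C\<close>.\<close>
  obtain w where w: "v \<rightarrow> w" "w \<rightarrow>\<^sup>* v"
    using tranclD[OF v] vG adj_in_verts reachable_conv by auto
  then have "w \<in> scc_of v" "v \<in> scc_of v"
    using vG by (auto simp: scc_of_def)
  then have "v \<rightarrow>\<^bsub>C\<^esub> w" "w \<rightarrow>\<^sup>*\<^bsub>C\<^esub> v"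
    using w(1) sc by (auto simp: C arcs_ends_conv strongly_connected_def)
  then have "v \<rightarrow>\<^sup>+\<^bsub>C\<^esub> v"
    by (meson C.reachable1_reachable_trans trancl.r_into_trancl)
  then obtain p where "C.awalk v p v" "p \<noteq> []"
    using C.reachable1_awalk by blast
  then have "C.closed_w p"
    by (auto simp: C.closed_w_def)
  then show "C \<in> cyclic_components G"
    using C.closed_w_imp_cycle scc by (auto simp: cyclic_components_def)
qed

text \<open>Vertices of one component reach each other, so the existentially chosen vertices in the
  order can be exchanged for the given representatives.\<close>

lemma (in wf_digraph) cyclic_component_order_iff:
  assumes "v \<in> verts G" "w \<in> verts G"
  shows "G \<restriction> scc_of v \<sqsubseteq>\<^bsub>cyclic_component_order G\<^esub> G \<restriction> scc_of w \<longleftrightarrow> v \<rightarrow>\<^sup>* w"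
proof
  show "v \<rightarrow>\<^sup>* w" if "G \<restriction> scc_of v \<sqsubseteq>\<^bsub>cyclic_component_order G\<^esub> G \<restriction> scc_of w"
    using that by (auto simp: cyclic_component_order_def scc_of_def intro: reachable_trans)
  show "G \<restriction> scc_of v \<sqsubseteq>\<^bsub>cyclic_component_order G\<^esub> G \<restriction> scc_of w" if "v \<rightarrow>\<^sup>* w"
    using that assms in_scc_of_self by (auto simp: cyclic_component_order_def)
qed

lemma (in wf_digraph) acyclic_part_conv:
  "acyclic_part G = {v \<in> verts G. \<forall>w. v \<rightarrow>\<^sup>* w \<longrightarrow> \<not> w \<rightarrow>\<^sup>+ w}"
proof -
  have "(\<exists>p. cycle p \<and> (\<exists>e\<in>set p. v \<rightarrow>\<^sup>* tail G e)) \<longleftrightarrow> (\<exists>w. v \<rightarrow>\<^sup>* w \<and> w \<rightarrow>\<^sup>+ w)" for v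
  proof
    assume "\<exists>p. cycle p \<and> (\<exists>e\<in>set p. v \<rightarrow>\<^sup>* tail G e)"
    then obtain p e u where p: "awalk u p u" "p \<noteq> []" "e \<in> set p" "v \<rightarrow>\<^sup>* tail G e"
      by (auto simp: cycle_def)
    \<comment> \<open>The closed walk can be started at any of its vertices, so the tail of
      \<open>e\<close> is itself recurrent.\<close>
    have "tail G e \<in> set (awalk_verts u p)"
      using p(3) by (rule awalk_verts_arc1)
    then have "u \<rightarrow>\<^sup>* tail G e" "tail G e \<rightarrow>\<^sup>* u"
      using p(1) awalk_verts_reachable_from awalk_verts_reachable_to by blast+
    moreover have "u \<rightarrow>\<^sup>+ u"
      using p(1,2) reachable1_awalk by blast
    ultimately have "tail G e \<rightarrow>\<^sup>+ tail G e"
      using reachable_reachable1_trans reachable1_reachable_trans by blast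
    then show "\<exists>w. v \<rightarrow>\<^sup>* w \<and> w \<rightarrow>\<^sup>+ w"
      using p(4) by blast
  next
    assume "\<exists>w. v \<rightarrow>\<^sup>* w \<and> w \<rightarrow>\<^sup>+ w"
    then obtain w where w: "v \<rightarrow>\<^sup>* w" "w \<rightarrow>\<^sup>+ w"
      by blast
    \<comment> \<open>Taking the cycle inside the component of \<open>w\<close> guarantees that it
      is reachable from \<open>w\<close>; its first arc serves as witness.\<close>
    then have "G \<restriction> scc_of w \<in> cyclic_components G"
      by (auto simp: cyclic_components_conv)
    then obtain p where C: "G \<restriction> scc_of w \<in> sccs" "pre_digraph.cycle (G \<restriction> scc_of w) p"
      by (auto simp: cyclic_components_def)
    then have "cycle p"
      by (intro subgraph_cycle[of "G \<restriction> scc_of w"]) (auto simp: sccs_def)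
    have p: "set p \<subseteq> arcs (G \<restriction> scc_of w)" "hd p \<in> set p"
      using C(2) by (auto simp: pre_digraph.cycle_def pre_digraph.awalk_def)
    moreover have "tail G (hd p) \<in> scc_of w"
      using subsetD[OF p] by simp
    then have "v \<rightarrow>\<^sup>* tail G (hd p)"
      using w(1) reachable_trans by (auto simp: scc_of_def)
    ultimately show "\<exists>p. cycle p \<and> (\<exists>e\<in>set p. v \<rightarrow>\<^sup>* tail G e)"
      using \<open>cycle p\<close> by blast
  qed
  then show ?thesis
    by (auto simp: acyclic_part_def)
qed

section \<open>Vertex sets attached to filters of cyclic components\<close>

definition filter_vertices :: "('v, 'e) pre_digraph \<Rightarrow> ('v, 'e) pre_digraph set \<Rightarrow> 'v set" where
  "filter_vertices E F =
     {v \<in> verts E. \<forall>w. v \<rightarrow>\<^sup>*\<^bsub>E\<^esub> w \<and> w \<rightarrow>\<^sup>+\<^bsub>E\<^esub> w \<longrightarrow> E \<restriction> pre_digraph.scc_of E w \<in> F}"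

text \<open>For a preorder, the principal filter of \<open>x\<close>.\<close>

definition up_set :: "('a, 'b) gorder_scheme \<Rightarrow> 'a \<Rightarrow> 'a set" where
  "up_set P x = {y \<in> carrier P. x \<sqsubseteq>\<^bsub>P\<^esub> y}"

context wf_digraph
begin

lemma acyclic_part_eq_filter_vertices: "acyclic_part G = filter_vertices G {}"
  by (auto simp: acyclic_part_conv filter_vertices_def)

lemma filter_vertices_mono: "F \<subseteq> F' \<Longrightarrow> filter_vertices G F \<subseteq> filter_vertices G F'"
  by (auto simp: filter_vertices_def)

lemma hereditary_filter_vertices: "hereditary G (filter_vertices G F)"
  unfolding hereditary_def
proof (intro conjI ballI impI)
  show "filter_vertices G F \<subseteq> verts G"
    by (auto simp: filter_vertices_def)
  fix e assume e: "e \<in> arcs G" "tail G e \<in> filter_vertices G F"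
  have "tail G e \<rightarrow>\<^sup>* w" if "head G e \<rightarrow>\<^sup>* w" for w
    using in_arcs_imp_in_arcs_ends[OF e(1)] that by (rule adj_reachable_trans)
  then show "head G e \<in> filter_vertices G F"
    using e by (auto simp: filter_vertices_def)
qed

lemma saturated_filter_vertices: "saturated G (filter_vertices G F)"
  unfolding saturated_def
proof (intro conjI allI impI; (elim conjE)?)
  show "filter_vertices G F \<subseteq> verts G"
    by (auto simp: filter_vertices_def)
  fix v assume reg: "regular_vertex G v" and sub: "head G ` out_arcs G v \<subseteq> filter_vertices G F"
  have succ: "x \<in> filter_vertices G F" if "v \<rightarrow> x" for x
    using that sub by (auto simp: arcs_ends_conv)
  have "G \<restriction> scc_of w \<in> F" if w: "v \<rightarrow>\<^sup>* w" "w \<rightarrow>\<^sup>+ w" for w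
  proof -
    \<comment> \<open>Every recurrent \<open>w\<close> reachable from \<open>v\<close> is reachable
      from a successor of \<open>v\<close>: if \<open>w = v\<close>, the first edge of its closed
      walk supplies the successor.\<close>
    obtain x where x: "v \<rightarrow> x" "x \<rightarrow>\<^sup>* w"
    proof (cases "v = w")
      case True
      then show thesis
        using that tranclD[OF w(2)] adj_in_verts reachable_conv w by auto
    next
      case False
      then show thesis
        using that w(1) by (metis converse_reachable_cases)
    qed
    then show ?thesis
      using succ[of x] w(2) by (auto simp: filter_vertices_def)
  qed
  then show "v \<in> filter_vertices G F"
    using reg by (auto simp: filter_vertices_def regular_vertex_def)
qed

text \<open>The vertex set recovers the filter. A recurrent vertex is among the vertices it reaches,
  which gives one direction; upward closure of \<open>F\<close> gives the other.\<close>

lemma recurrent_in_filter_vertices_iff: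
  assumes "poset_filter (cyclic_component_order G) F" "w \<rightarrow>\<^sup>+ w"
  shows "w \<in> filter_vertices G F \<longleftrightarrow> G \<restriction> scc_of w \<in> F"
proof
  have w: "w \<in> verts G"
    using assms(2) reachable1_in_verts by blast
  then show "G \<restriction> scc_of w \<in> F" if "w \<in> filter_vertices G F"
    using that assms(2) by (auto simp: filter_vertices_def)
  show "w \<in> filter_vertices G F" if "G \<restriction> scc_of w \<in> F"
  proof -
    have "G \<restriction> scc_of x \<in> F" if x: "w \<rightarrow>\<^sup>* x" "x \<rightarrow>\<^sup>+ x" for x
    proof -
      have "G \<restriction> scc_of w \<sqsubseteq>\<^bsub>cyclic_component_order G\<^esub> G \<restriction> scc_of x"
        using x w by (subst cyclic_component_order_iff) (auto dest: reachable_in_verts)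
      moreover have "G \<restriction> scc_of x \<in> carrier (cyclic_component_order G)"
        using x by (auto simp: cyclic_component_order_def cyclic_components_conv)
      ultimately show ?thesis
        using assms(1) \<open>G \<restriction> scc_of w \<in> F\<close> unfolding poset_filter_def by blast
    qed
    then show ?thesis
      using w by (auto simp: filter_vertices_def)
  qed
qed

lemma filter_vertices_subset_iff:
  assumes F: "poset_filter (cyclic_component_order G) F"
    and F': "poset_filter (cyclic_component_order G) F'"
  shows "filter_vertices G F \<subseteq> filter_vertices G F' \<longleftrightarrow> F \<subseteq> F'"
proof
  assume sub: "filter_vertices G F \<subseteq> filter_vertices G F'"
  show "F \<subseteq> F'"
  proof
    fix C assume C: "C \<in> F"
    then have "C \<in> cyclic_components G"
      using F by (auto simp: poset_filter_def cyclic_component_order_def)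
    then obtain w where w: "C = G \<restriction> scc_of w" "w \<rightarrow>\<^sup>+ w"
      by (auto simp: cyclic_components_conv)
    then show "C \<in> F'"
      using C sub recurrent_in_filter_vertices_iff[OF F, of w]
        recurrent_in_filter_vertices_iff[OF F', of w] by auto
  qed
qed (rule filter_vertices_mono)

text \<open>Passing to representatives turns transitivity of the component order into transitivity
  of reachability.\<close>

lemma poset_filter_up_set:
  "C \<in> cyclic_components G \<Longrightarrow>
    poset_filter (cyclic_component_order G) (up_set (cyclic_component_order G) C)"
proof -
  assume "C \<in> cyclic_components G"
  then have "C \<sqsubseteq>\<^bsub>cyclic_component_order G\<^esub> B"
    if "C \<sqsubseteq>\<^bsub>cyclic_component_order G\<^esub> A" "A \<sqsubseteq>\<^bsub>cyclic_component_order G\<^esub> B"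
      "A \<in> cyclic_components G" "B \<in> cyclic_components G" for A B
    using that reachable1_in_verts
    by (auto simp: cyclic_components_conv cyclic_component_order_iff intro: reachable_trans)
  then show ?thesis
    by (auto simp: poset_filter_def up_set_def) (auto simp: cyclic_component_order_def)
qed

lemma up_set_subset_iff:
  assumes "poset_filter (cyclic_component_order G) F" "C \<in> cyclic_components G"
  shows "up_set (cyclic_component_order G) C \<subseteq> F \<longleftrightarrow> C \<in> F"
proof
  have "C \<sqsubseteq>\<^bsub>cyclic_component_order G\<^esub> C"
    using assms(2) reachable1_in_verts by (auto simp: cyclic_components_conv cyclic_component_order_iff)
  then show "C \<in> F" if "up_set (cyclic_component_order G) C \<subseteq> F"
    using that assms(2) by (auto simp: up_set_def cyclic_component_order_def)
  show "up_set (cyclic_component_order G) C \<subseteq> F" if "C \<in> F"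
    using that assms(1) by (auto simp: up_set_def poset_filter_def)
qed

end

section \<open>Filters and nonempty hereditary saturated sets in a sandpile graph\<close>

context sandpile_graph
begin

lemma sink_in_verts: "s \<in> verts E"
  using is_sink_iff[of s] by (auto simp: is_sink_def)

lemma not_sink_dominates: "\<not> s \<rightarrow>\<^bsub>E\<^esub> v"
  using is_sink_iff[of s] by (auto simp: is_sink_def arcs_ends_conv)

text \<open>The sink reaches only itself and is not recurrent, so the condition is vacuous. In
  particular these vertex sets are never empty.\<close>

lemma sink_in_filter_vertices: "s \<in> filter_vertices E F"
  using sink_in_verts not_sink_dominates
  by (auto simp: filter_vertices_def dest: tranclD elim: converse_reachable_cases)

lemma sink_in_hereditary:
  assumes "hereditary E H" "H \<noteq> {}"
  shows "s \<in> H"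
proof -
  obtain v where "v \<in> H" "v \<in> verts E"
    using assms by (auto simp: hereditary_def)
  then show ?thesis
    using hereditary_reachable[OF assms(1) reaches_sink] by blast
qed

lemma regular_vertex_iff: "regular_vertex E v \<longleftrightarrow> v \<in> verts E - {s}"
  by (auto simp: regular_vertex_def is_sink_iff finite_out_arcs)

lemma recurrent_outside:
  assumes H: "H \<noteq> {}" "hereditary E H" "saturated E H" and v: "v \<in> verts E" "v \<notin> H"
  obtains w where "v \<rightarrow>\<^sup>*\<^bsub>E\<^esub> w" "w \<rightarrow>\<^sup>+\<^bsub>E\<^esub> w" "w \<notin> H"
proof -
  define X where "X = {w. v \<rightarrow>\<^sup>*\<^bsub>E\<^esub> w \<and> w \<notin> H}"
  define r where "r = arcs_ends E \<inter> X \<times> X"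
  have succ: "\<exists>y\<in>X. (x, y) \<in> r" if x: "x \<in> X" for x
  proof -
    \<comment> \<open>The sink lies in \<open>H\<close>, so \<open>x\<close> is regular, and
      saturation forces an edge from \<open>x\<close> to a vertex outside \<open>H\<close>.\<close>
    have "regular_vertex E x"
      using x sink_in_hereditary[OF H(2,1)] by (auto simp: X_def regular_vertex_iff dest: reachable_in_verts(2))
    then have "\<not> head E ` out_arcs E x \<subseteq> H"
      using x H(3) by (auto simp: X_def saturated_def)
    then obtain e where "e \<in> out_arcs E x" "head E e \<notin> H"
      by blast
    then have "x \<rightarrow>\<^bsub>E\<^esub> head E e" "head E e \<notin> H"
      using in_arcs_imp_in_arcs_ends by auto
    then show ?thesis
      using x reachable_adj_trans by (auto simp: r_def X_def)
  qed
  have "X \<subseteq> verts E"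
    by (auto simp: X_def dest: reachable_in_verts(2))
  then have "finite X"
    by (rule finite_subset) simp
  then have "finite r"
    by (auto simp: r_def)
  have "\<not> acyclic r"
  \<comment> \<open>A finite acyclic relation has a well-founded converse, so some element of
    \<open>X\<close> would have no successor in \<open>X\<close>.\<close>
  proof
    assume "acyclic r"
    then have "wf (r\<inverse>)"
      using \<open>finite r\<close> by (rule finite_acyclic_wf_converse[rotated])
    moreover have "v \<in> X"
      using v by (auto simp: X_def)
    ultimately obtain x where "x \<in> X" "\<And>y. (y, x) \<in> r\<inverse> \<Longrightarrow> y \<notin> X"
      by (metis wfE_min)
    then show False
      using succ by blast
  qed
  then obtain w where w: "(w, w) \<in> r\<^sup>+"
    by (auto simp: acyclic_def)
  then have "w \<in> X"
    by (auto simp: r_def dest: tranclD)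
  moreover have "w \<rightarrow>\<^sup>+\<^bsub>E\<^esub> w"
    using w by (rule trancl_mono) (auto simp: r_def)
  ultimately show thesis
    using that by (auto simp: X_def)
qed

lemma hereditary_saturated_eq_filter_vertices:
  assumes H: "H \<noteq> {}" "hereditary E H" "saturated E H"
  obtains F where "poset_filter (cyclic_component_order E) F" "H = filter_vertices E F"
proof
  \<comment> \<open>Full containment is no stronger than meeting \<open>H\<close>: a hereditary set
    with one vertex of a strong component contains all of them.\<close>
  let ?F = "{C \<in> cyclic_components E. verts C \<subseteq> H}"
  show "poset_filter (cyclic_component_order E) ?F"
    unfolding poset_filter_def
  proof (intro conjI ballI impI)
    show "?F \<subseteq> carrier (cyclic_component_order E)"
      by (auto simp: cyclic_component_order_def)
    fix A B assume "A \<in> ?F" "B \<in> carrier (cyclic_component_order E)"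
      and le: "A \<sqsubseteq>\<^bsub>cyclic_component_order E\<^esub> B"
    then have B: "B \<in> cyclic_components E" and "verts A \<subseteq> H"
      by (auto simp: cyclic_component_order_def)
    then obtain v where v: "v \<in> verts B" "v \<in> H"
      using le hereditary_reachable[OF H(2)] by (auto simp: cyclic_component_order_def)
    from B v(1) have "v \<rightarrow>\<^sup>*\<^bsub>E\<^esub> w" if "w \<in> verts B" for w
      using that by (auto simp: cyclic_components_conv scc_of_def intro: reachable_trans)
    then show "B \<in> ?F"
      using B v(2) hereditary_reachable[OF H(2)] by blast
  qed
  show "H = filter_vertices E ?F"
  proof (intro subset_antisym subsetI)
    fix v assume v: "v \<in> H"
    then have "v \<in> verts E"
      using H(2) by (auto simp: hereditary_def)
    moreover have "scc_of w \<subseteq> H" if "v \<rightarrow>\<^sup>*\<^bsub>E\<^esub> w" for w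
      using that v hereditary_reachable[OF H(2)] by (auto simp: scc_of_def)
    ultimately show "v \<in> filter_vertices E ?F"
      by (auto simp: filter_vertices_def cyclic_components_conv)
  next
    fix v assume v: "v \<in> filter_vertices E ?F"
    show "v \<in> H"
    proof (rule ccontr)
      assume "v \<notin> H"
      then obtain w where w: "v \<rightarrow>\<^sup>*\<^bsub>E\<^esub> w" "w \<rightarrow>\<^sup>+\<^bsub>E\<^esub> w" "w \<notin> H"
        using recurrent_outside[OF H, of v] v by (auto simp: filter_vertices_def)
      then have "E \<restriction> scc_of w \<in> ?F"
        using v by (auto simp: filter_vertices_def)
      moreover have "w \<in> scc_of w"
        using w(1) reachable_in_verts(2) in_scc_of_self by blast
      ultimately show False
        using w(3) by auto
    qed
  qed
qed

lemma filter_lattice_hereditary_saturated: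
  "order_isomorphic (filter_lattice E) (hereditary_saturated_lattice E)"
proof (rule order_isomorphicI[where f = "filter_vertices E"])
  show "filter_vertices E ` carrier (filter_lattice E) = carrier (hereditary_saturated_lattice E)"
  proof (intro subset_antisym subsetI)
    fix H assume "H \<in> carrier (hereditary_saturated_lattice E)"
    then obtain F where "poset_filter (cyclic_component_order E) F" "H = filter_vertices E F"
      using hereditary_saturated_eq_filter_vertices[of H]
      by (auto simp: hereditary_saturated_lattice_def)
    then show "H \<in> filter_vertices E ` carrier (filter_lattice E)"
      by (simp add: filter_lattice_def)
  next
    fix H assume "H \<in> filter_vertices E ` carrier (filter_lattice E)"
    then obtain F where "H = filter_vertices E F"
      by blast
    then show "H \<in> carrier (hereditary_saturated_lattice E)"
      using hereditary_filter_vertices saturated_filter_vertices sink_in_filter_vertices[of F]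
      by (auto simp: hereditary_saturated_lattice_def)
  qed
qed (auto simp: filter_lattice_def hereditary_saturated_lattice_def filter_vertices_subset_iff)

section \<open>Closures of components and ideals of closures\<close>

lemma hereditary_saturated_closure_component:
  assumes C: "C \<in> cyclic_components E"
  shows "hereditary_saturated_closure E (verts C) =
    filter_vertices E (up_set (cyclic_component_order E) C)"
  unfolding hereditary_saturated_closure_def
proof (rule hull_unique)
  let ?F = "up_set (cyclic_component_order E) C"
  have F: "poset_filter (cyclic_component_order E) ?F"
    using C by (rule poset_filter_up_set)
  obtain w where w: "C = E \<restriction> scc_of w" "w \<rightarrow>\<^sup>+\<^bsub>E\<^esub> w"
    using C by (auto simp: cyclic_components_conv)
  have "C \<in> ?F"
    using up_set_subset_iff[OF F C] by blast
  then have "w \<in> filter_vertices E ?F"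
    using recurrent_in_filter_vertices_iff[OF F w(2)] w(1) by simp
  then show "verts C \<subseteq> filter_vertices E ?F"
    using w(1) hereditary_reachable[OF hereditary_filter_vertices] by (auto simp: scc_of_def)
  show "hereditary E (filter_vertices E ?F) \<and> saturated E (filter_vertices E ?F)"
    using hereditary_filter_vertices saturated_filter_vertices by blast
  fix K assume K: "verts C \<subseteq> K" "hereditary E K \<and> saturated E K"
  \<comment> \<open>For minimality: \<open>K\<close> is nonempty, hence the vertex set of a filter
    \<open>F'\<close>. Its recurrent vertex \<open>w\<close> puts \<open>C\<close> into
    \<open>F'\<close>, and with it the principal filter of \<open>C\<close>.\<close>
  have "w \<in> K"
    using w(1) K(1) in_scc_of_self[OF reachable1_in_verts(1)[OF w(2)]] by auto
  then obtain F' where F': "poset_filter (cyclic_component_order E) F'" "K = filter_vertices E F'"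
    using hereditary_saturated_eq_filter_vertices[of K] K(2) by blast
  then have "C \<in> F'"
    using recurrent_in_filter_vertices_iff[OF F'(1) w(2)] w(1) \<open>w \<in> K\<close> by simp
  then show "filter_vertices E ?F \<subseteq> K"
    using up_set_subset_iff[OF F'(1) C] filter_vertices_mono F'(2) by simp
qed

text \<open>The acyclic part belongs to the empty filter, so every element of this poset is the
  vertex set of a filter.\<close>

lemma Hs_order_conv:
  "Hs_order E = inclusion_order (insert (filter_vertices E {})
     ((\<lambda>C. filter_vertices E (up_set (cyclic_component_order E) C)) ` cyclic_components E))"
  by (simp add: Hs_order_def acyclic_part_eq_filter_vertices hereditary_saturated_closure_component
      cong: image_cong)

lemma poset_ideal_Hs_order:
  assumes I: "poset_ideal (Hs_order E) I"
  obtains F where "poset_filter (cyclic_component_order E) F"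
    "I = {K \<in> carrier (Hs_order E). K \<subseteq> filter_vertices E F}"
proof
  let ?up = "\<lambda>C. filter_vertices E (up_set (cyclic_component_order E) C)"
  let ?F = "{C \<in> cyclic_components E. ?up C \<in> I}"
  have down: "K \<in> I" if "K \<in> carrier (Hs_order E)" "K \<subseteq> K'" "K' \<in> I" for K K'
    using that I by (auto simp: poset_ideal_def Hs_order_def)
  have up: "?up B \<in> I" if "B \<in> cyclic_components E" "?up B \<subseteq> K" "K \<in> I" for B K
    by (rule down[OF _ that(2,3)]) (use that(1) in \<open>auto simp: Hs_order_conv\<close>)
  \<comment> \<open>An ideal is nonempty and so contains the least element; beyond it, the ideal is
    described by closures of components.\<close>
  have empty: "filter_vertices E {} \<in> I"
  proof -
    obtain K where K: "K \<in> I"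
      using I by (auto simp: poset_ideal_def)
    then have "K \<in> carrier (Hs_order E)"
      using I by (auto simp: poset_ideal_def)
    then have "filter_vertices E {} \<subseteq> K"
      unfolding Hs_order_conv using filter_vertices_mono[OF empty_subsetI] by auto
    then show ?thesis
      using K by (rule down[rotated]) (simp add: Hs_order_conv)
  qed
  show F: "poset_filter (cyclic_component_order E) ?F"
    unfolding poset_filter_def
  proof (intro conjI ballI impI)
    show "?F \<subseteq> carrier (cyclic_component_order E)"
      by (auto simp: cyclic_component_order_def)
    fix A B assume A: "A \<in> ?F" and B: "B \<in> carrier (cyclic_component_order E)"
      and le: "A \<sqsubseteq>\<^bsub>cyclic_component_order E\<^esub> B"
    have Bc: "B \<in> cyclic_components E"
      using B by (simp add: cyclic_component_order_def)
    have "B \<in> up_set (cyclic_component_order E) A"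
      using B le by (simp add: up_set_def)
    \<comment> \<open>The correspondence reverses order: a larger component has a smaller closure,
      so the down-set \<open>I\<close> yields an up-set of components.\<close>
    then have "?up B \<subseteq> ?up A"
      using up_set_subset_iff[OF poset_filter_up_set Bc] A filter_vertices_mono by blast
    then show "B \<in> ?F"
      using up A Bc by blast
  qed
  have "?up C \<subseteq> filter_vertices E ?F \<longleftrightarrow> ?up C \<in> I" if "C \<in> cyclic_components E" for C
    using that up_set_subset_iff[OF F that] filter_vertices_subset_iff[OF poset_filter_up_set[OF that] F]
    by simp
  then have "K \<subseteq> filter_vertices E ?F \<longleftrightarrow> K \<in> I" if "K \<in> carrier (Hs_order E)" for K
    using that empty filter_vertices_mono[of "{}" ?F]
    unfolding Hs_order_conv inclusion_order_simps by blast
  moreover have "I \<subseteq> carrier (Hs_order E)"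
    using I by (simp add: poset_ideal_def)
  ultimately show "I = {K \<in> carrier (Hs_order E). K \<subseteq> filter_vertices E ?F}"
    by blast
qed

lemma filter_lattice_Hs_ideal:
  "order_isomorphic (filter_lattice E) (Hs_ideal_lattice E)"
proof (rule order_isomorphicI[where f = "\<lambda>F. {K \<in> carrier (Hs_order E). K \<subseteq> filter_vertices E F}"])
  let ?f = "\<lambda>F. {K \<in> carrier (Hs_order E). K \<subseteq> filter_vertices E F}"
  \<comment> \<open>The vertex set of the empty filter lies below every other, so these down-sets
    are nonempty.\<close>
  have "poset_ideal (Hs_order E) (?f F)" for F
    using filter_vertices_mono[of "{}" F] by (auto simp: poset_ideal_def Hs_order_conv)
  then show "?f ` carrier (filter_lattice E) = carrier (Hs_ideal_lattice E)"
    using poset_ideal_Hs_order by (fastforce simp: filter_lattice_def Hs_ideal_lattice_def)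
  fix F F' assume "F \<in> carrier (filter_lattice E)" "F' \<in> carrier (filter_lattice E)"
  then have F: "poset_filter (cyclic_component_order E) F"
    and F': "poset_filter (cyclic_component_order E) F'"
    by (simp_all add: filter_lattice_def)
  \<comment> \<open>Tested on single components: \<open>C\<close> lies in a filter exactly when its
    closure lies in the corresponding ideal.\<close>
  have "F \<subseteq> F'" if sub: "?f F \<subseteq> ?f F'"
  proof
    fix C assume CF: "C \<in> F"
    then have C: "C \<in> cyclic_components E"
      using F by (auto simp: poset_filter_def cyclic_component_order_def)
    have "filter_vertices E (up_set (cyclic_component_order E) C) \<in> ?f F"
      using C CF up_set_subset_iff[OF F C] filter_vertices_mono by (auto simp: Hs_order_conv)
    then have "filter_vertices E (up_set (cyclic_component_order E) C) \<subseteq> filter_vertices E F'"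
      using sub by blast
    then show "C \<in> F'"
      using up_set_subset_iff[OF F' C] filter_vertices_subset_iff[OF poset_filter_up_set[OF C] F']
      by simp
  qed
  then show "?f F \<sqsubseteq>\<^bsub>Hs_ideal_lattice E\<^esub> ?f F' \<longleftrightarrow> F \<sqsubseteq>\<^bsub>filter_lattice E\<^esub> F'"
    using filter_vertices_mono[of F F'] by (auto simp: Hs_ideal_lattice_def filter_lattice_def)
qed (auto simp: filter_lattice_def)

end

lemma lattice_filter_lattice: "lattice (filter_lattice E)"
  unfolding filter_lattice_def
  by (rule lattice_inclusion_order) (auto simp: poset_filter_def)

section \<open>The sandpile monoid\<close>

lemma quotient_mult:
  assumes r: "monoid_congruence M r" and a: "a \<in> carrier M" and b: "b \<in> carrier M"
  shows "r `` {a} \<otimes>\<^bsub>quotient_monoid M r\<^esub> r `` {b} = r `` {a \<otimes>\<^bsub>M\<^esub> b}"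
proof -
  have eq: "equiv (carrier M) r"
    using r by (simp add: monoid_congruence_def)
  \<comment> \<open>Any product of representatives generates the same class, so the image of the
    elementwise product is that one class; reflexivity ensures that a product exists.\<close>
  have "r `` {x \<otimes>\<^bsub>M\<^esub> y} = r `` {a \<otimes>\<^bsub>M\<^esub> b}" if "(a, x) \<in> r" "(b, y) \<in> r" for x y
    using that r eq by (metis equiv_class_eq monoid_congruence_def)
  moreover have "(a, a) \<in> r" "(b, b) \<in> r"
    using eq a b by (auto simp: equiv_def refl_on_def)
  ultimately have "r `` (r `` {a} <#>\<^bsub>M\<^esub> r `` {b}) = r `` {a \<otimes>\<^bsub>M\<^esub> b}"
    unfolding set_mult_def by blast
  then show ?thesis
    by (simp add: quotient_monoid_def)
qed

lemma comm_monoid_quotient: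
  assumes "comm_monoid M" and r: "monoid_congruence M r"
  shows "comm_monoid (quotient_monoid M r)"
proof -
  interpret comm_monoid M by fact
  let ?Q = "quotient_monoid M r"
  have rep: "\<exists>a\<in>carrier M. x = r `` {a}" if "x \<in> carrier ?Q" for x
    using that by (auto simp: quotient_monoid_def elim: quotientE)
  have class_in: "r `` {a} \<in> carrier ?Q" if "a \<in> carrier M" for a
    using that by (auto simp: quotient_monoid_def intro: quotientI)
  have one: "\<one>\<^bsub>?Q\<^esub> = r `` {\<one>\<^bsub>M\<^esub>}"
    by (simp add: quotient_monoid_def)
  show ?thesis
  proof (rule comm_monoidI)
    fix x y z assume "x \<in> carrier ?Q" "y \<in> carrier ?Q" "z \<in> carrier ?Q"
    then obtain a b c where "a \<in> carrier M" "b \<in> carrier M" "c \<in> carrier M"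
      "x = r `` {a}" "y = r `` {b}" "z = r `` {c}"
      using rep by metis
    then show "x \<otimes>\<^bsub>?Q\<^esub> y \<otimes>\<^bsub>?Q\<^esub> z = x \<otimes>\<^bsub>?Q\<^esub> (y \<otimes>\<^bsub>?Q\<^esub> z)"
      by (simp add: quotient_mult[OF r] m_assoc)
  next
    fix x y assume "x \<in> carrier ?Q" "y \<in> carrier ?Q"
    then obtain a b where "a \<in> carrier M" "b \<in> carrier M" "x = r `` {a}" "y = r `` {b}"
      using rep by metis
    then show "x \<otimes>\<^bsub>?Q\<^esub> y \<in> carrier ?Q" "x \<otimes>\<^bsub>?Q\<^esub> y = y \<otimes>\<^bsub>?Q\<^esub> x"
      by (simp_all add: quotient_mult[OF r] class_in m_comm)
  next
    fix x assume "x \<in> carrier ?Q"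
    then obtain a where "a \<in> carrier M" "x = r `` {a}"
      using rep by metis
    then show "\<one>\<^bsub>?Q\<^esub> \<otimes>\<^bsub>?Q\<^esub> x = x"
      by (simp add: quotient_mult[OF r] one)
  qed (simp add: one class_in)
qed

lemma comm_monoid_free: "comm_monoid (free_comm_monoid X)"
  by (rule comm_monoidI) (auto simp: free_comm_monoid_def)

lemma monoid_congruence_hull:
  assumes "monoid M" "R \<subseteq> carrier M \<times> carrier M"
  shows "monoid_congruence M (monoid_congruence M hull R)"
proof -
  interpret monoid M by fact
  define T where "T = {t. monoid_congruence M t \<and> R \<subseteq> t}"
  \<comment> \<open>The total relation shows that the intersected family is nonempty and keeps the
    intersection inside the carrier.\<close>
  have "carrier M \<times> carrier M \<in> T"
    using assms by (auto simp: T_def monoid_congruence_def intro!: equivI reflI symI transI refl_onI)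
  then have "\<Inter>T \<subseteq> carrier M \<times> carrier M"
    by (rule Inter_lower)
  moreover have eq: "refl_on (carrier M) t \<and> sym t \<and> trans t" if "t \<in> T" for t
    using that by (simp add: T_def monoid_congruence_def equiv_def)
  then have "refl_on (carrier M) (\<Inter>T)"
    by (simp add: refl_on_def)
  moreover have "sym (\<Inter>T)"
    using eq by (meson InterD InterI symD symI)
  moreover have "trans (\<Inter>T)"
    using eq by (meson InterD InterI transD transI)
  ultimately have "equiv (carrier M) (\<Inter>T)"
    by (simp add: equiv_def)
  moreover have "(a \<otimes>\<^bsub>M\<^esub> c, b \<otimes>\<^bsub>M\<^esub> d) \<in> \<Inter>T" if "(a, b) \<in> \<Inter>T" "(c, d) \<in> \<Inter>T" for a b c d
    using that unfolding T_def monoid_congruence_def by blast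
  ultimately show ?thesis
    unfolding hull_def T_def[symmetric] by (auto simp: monoid_congruence_def)
qed

section \<open>Chip configurations modulo the sandpile relations\<close>

context sandpile_graph
begin

lemma out_arcs_nonempty: "v \<in> verts E - {s} \<Longrightarrow> out_arcs E v \<noteq> {}"
  using is_sink_iff[of v] by (auto simp: is_sink_def)

text \<open>A multiset of vertices is read as a chip configuration; this is the congruence whose
  quotient is \<open>SP E s\<close>.\<close>

definition config_equiv :: "('v multiset \<times> 'v multiset) set" where
  "config_equiv = monoid_congruence (free_comm_monoid (verts E)) hull sandpile_relations E s"

definition config_class :: "'v multiset \<Rightarrow> 'v multiset set" where
  "config_class A = config_equiv `` {A}"

lemma sandpile_relations_carrier:
  "sandpile_relations E s \<subseteq> carrier (free_comm_monoid (verts E)) \<times> carrier (free_comm_monoid (verts E))"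
  using sink_in_verts by (auto simp: sandpile_relations_def free_comm_monoid_def finite_out_arcs split: if_split_asm)

lemma monoid_congruence_config_equiv:
  "monoid_congruence (free_comm_monoid (verts E)) config_equiv"
  unfolding config_equiv_def
  using comm_monoid_free sandpile_relations_carrier
  by (intro monoid_congruence_hull) (auto simp: comm_monoid_def)

lemma config_equiv_equiv: "equiv {A. set_mset A \<subseteq> verts E} config_equiv"
  using monoid_congruence_config_equiv by (simp add: monoid_congruence_def free_comm_monoid_def)

lemma config_equiv_add:
  "(A, B) \<in> config_equiv \<Longrightarrow> (A', B') \<in> config_equiv \<Longrightarrow> (A + A', B + B') \<in> config_equiv"
  using monoid_congruence_config_equiv by (simp add: monoid_congruence_def free_comm_monoid_def)

lemma config_equiv_refl: "set_mset A \<subseteq> verts E \<Longrightarrow> (A, A) \<in> config_equiv"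
  using config_equiv_equiv by (simp add: equiv_def refl_on_def)

lemma config_equiv_trans:
  "(A, B) \<in> config_equiv \<Longrightarrow> (B, C) \<in> config_equiv \<Longrightarrow> (A, C) \<in> config_equiv"
  using config_equiv_equiv by (meson equivE transE)

lemma config_equiv_relation: "(A, B) \<in> sandpile_relations E s \<Longrightarrow> (A, B) \<in> config_equiv"
  unfolding config_equiv_def by (rule hull_inc)

lemma config_equiv_sink: "({#s#}, {#}) \<in> config_equiv"
  by (rule config_equiv_relation) (simp add: sandpile_relations_def)

lemma config_equiv_topple:
  "v \<in> verts E - {s} \<Longrightarrow>
    (replicate_mset (out_degree E v) v, image_mset (head E) (mset_set (out_arcs E v))) \<in> config_equiv"
  by (rule config_equiv_relation) (auto simp: sandpile_relations_def)

lemma config_class_eq_iff: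
  assumes "set_mset A \<subseteq> verts E" "set_mset B \<subseteq> verts E"
  shows "config_class A = config_class B \<longleftrightarrow> (A, B) \<in> config_equiv"
  unfolding config_class_def using eq_equiv_class_iff[OF config_equiv_equiv] assms by simp

lemma SP_conv: "SP E s = quotient_monoid (free_comm_monoid (verts E)) config_equiv"
  by (simp add: SP_def presented_comm_monoid_def config_equiv_def)

lemma SP_carrier: "carrier (SP E s) = config_class ` {A. set_mset A \<subseteq> verts E}"
  by (auto simp: SP_conv quotient_monoid_def config_class_def free_comm_monoid_def quotient_def)

lemma SP_one: "\<one>\<^bsub>SP E s\<^esub> = config_class {#}"
  by (simp add: SP_conv quotient_monoid_def config_class_def free_comm_monoid_def)

lemma SP_mult:
  assumes "set_mset A \<subseteq> verts E" "set_mset B \<subseteq> verts E"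
  shows "config_class A \<otimes>\<^bsub>SP E s\<^esub> config_class B = config_class (A + B)"
  using quotient_mult[OF monoid_congruence_config_equiv, of A B] assms
  by (simp add: SP_conv config_class_def) (simp add: free_comm_monoid_def)

lemma comm_monoid_SP: "comm_monoid (SP E s)"
  unfolding SP_conv
  using comm_monoid_free monoid_congruence_config_equiv by (rule comm_monoid_quotient)

lemma config_class_in_SP: "set_mset A \<subseteq> verts E \<Longrightarrow> config_class A \<in> carrier (SP E s)"
  by (auto simp: SP_carrier)

section \<open>Stabilisation and finiteness of the sandpile monoid\<close>

lemma distance_to_sink:
  obtains d :: "'v \<Rightarrow> nat"
    where "\<And>v. v \<in> verts E - {s} \<Longrightarrow> \<exists>e\<in>out_arcs E v. d (head E e) < d v"
proof -
  define d where "d v = (LEAST n. (v, s) \<in> arcs_ends E ^^ n)" for v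
  have "\<exists>e\<in>out_arcs E v. d (head E e) < d v" if v: "v \<in> verts E - {s}" for v
  proof -
    have "(v, s) \<in> (arcs_ends E)\<^sup>*"
      using v by (intro reachable_rtranclI reaches_sink) simp
    then have path: "(v, s) \<in> arcs_ends E ^^ d v"
      unfolding d_def by (meson LeastI_ex rtrancl_power)
    \<comment> \<open>As \<open>v\<close> is not the sink, its distance is positive; the first edge
      of a shortest path then decreases it.\<close>
    then obtain m where m: "d v = Suc m"
      using v by (cases "d v") auto
    then obtain y where y: "(v, y) \<in> arcs_ends E" "(y, s) \<in> arcs_ends E ^^ m"
      using path relpow_Suc_D2 by metis
    then have "d y \<le> m"
      unfolding d_def by (intro Least_le)
    moreover obtain e where "e \<in> arcs E" "tail E e = v" "head E e = y"
      using y(1) by (auto simp: arcs_ends_conv)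
    ultimately show ?thesis
      using m by (intro bexI[of _ e]) auto
  qed
  then show thesis
    using that by blast
qed

text \<open>
  Give a chip at distance \<open>d\<close> from the sink the credit \<open>K ^ (D - d)\<close>, with \<open>K\<close> larger than every
  out-degree: a single chip that moves closer to the sink then gains more credit than all the
  toppled chips had.  The weight is the complementary quantity, shifted to be positive.
\<close>

lemma toppling_weight:
  obtains w :: "'v \<Rightarrow> nat"
    where "\<And>v. 0 < w v"
      and "\<And>v. v \<in> verts E - {s} \<Longrightarrow> (\<Sum>e\<in>out_arcs E v. w (head E e)) < out_degree E v * w v"
proof -
  obtain d :: "'v \<Rightarrow> nat"
    where d: "\<And>v. v \<in> verts E - {s} \<Longrightarrow> \<exists>e\<in>out_arcs E v. d (head E e) < d v"
    using distance_to_sink by blast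
  define D where "D = Max (d ` verts E)"
  have D: "d v \<le> D" if "v \<in> verts E" for v
    using that by (simp add: D_def)
  define K where "K = Suc (card (arcs E))"
  define c where "c v = K ^ (D - d v)" for v
  define w where "w v = Suc (K ^ D - c v)" for v
  \<comment> \<open>Since \<open>c v\<close> is at most \<open>K ^ D\<close>, the truncated
    subtraction in \<open>w\<close> is exact.\<close>
  have wc: "w v + c v = Suc (K ^ D)" for v
    by (simp add: w_def c_def K_def power_increasing)
  have "(\<Sum>e\<in>out_arcs E v. w (head E e)) < out_degree E v * w v" if v: "v \<in> verts E - {s}" for v
  proof -
    obtain e where e: "e \<in> out_arcs E v" "d (head E e) < d v"
      using d[OF v] by blast
    have "out_degree E v < K"
      unfolding out_degree_def K_def less_Suc_eq_le
      by (rule card_mono) (auto simp: out_arcs_def)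
    then have "out_degree E v * c v < K * c v"
      by (rule mult_strict_right_mono) (simp add: c_def K_def)
    also have "K * c v \<le> c (head E e)"
    proof -
      have "Suc (D - d v) \<le> D - d (head E e)"
        using e D[of v] v by simp
      then have "K ^ Suc (D - d v) \<le> K ^ (D - d (head E e))"
        by (rule power_increasing) (simp add: K_def)
      then show ?thesis
        by (simp add: c_def)
    qed
    also have "c (head E e) \<le> (\<Sum>e\<in>out_arcs E v. c (head E e))"
      using e(1) finite_out_arcs[of v] by (intro member_le_sum) auto
    finally have "out_degree E v * c v < (\<Sum>e\<in>out_arcs E v. c (head E e))" .
    \<comment> \<open>Weight and credit of a chip add up to the same constant, and both sides count
      one chip for each edge leaving \<open>v\<close>. A strict gain in credit is therefore a strict
      loss in weight.\<close>
    moreover have "(\<Sum>e\<in>out_arcs E v. w (head E e)) + (\<Sum>e\<in>out_arcs E v. c (head E e)) =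
        out_degree E v * w v + out_degree E v * c v"
      by (simp add: sum.distrib[symmetric] distrib_left[symmetric] wc out_degree_def
          del: mult_Suc_right)
    ultimately show ?thesis
      by linarith
  qed
  moreover have "0 < w v" for v
    by (simp add: w_def)
  ultimately show thesis
    using that by blast
qed

definition stable :: "'v multiset \<Rightarrow> bool" where
  "stable A \<longleftrightarrow> s \<notin># A \<and> (\<forall>v\<in>verts E - {s}. count A v < out_degree E v)"

text \<open>Induction on total weight. An unstable configuration has a chip on the sink, which can
  be discarded, or a vertex that can topple; each move preserves the class and lowers the
  weight.\<close>

lemma stabilisation:
  assumes "set_mset A \<subseteq> verts E"
  shows "\<exists>B. set_mset B \<subseteq> verts E \<and> stable B \<and> (A, B) \<in> config_equiv"
proof -
  obtain w :: "'v \<Rightarrow> nat" where pos: "\<And>v. 0 < w v"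
    and topple: "\<And>v. v \<in> verts E - {s} \<Longrightarrow>
      (\<Sum>e\<in>out_arcs E v. w (head E e)) < out_degree E v * w v"
    using toppling_weight by blast
  define W where "W B = (\<Sum>v\<in>#B. w v)" for B
  show ?thesis
    using assms
  proof (induction "W A" arbitrary: A rule: less_induct)
    case less
    \<comment> \<open>Treats both moves at once: a part \<open>L\<close> of \<open>A\<close> is
      exchanged for an equivalent lighter \<open>R\<close>.\<close>
    have reduce: ?case
      if equ: "(L, R) \<in> config_equiv" and W: "W R < W L" and L: "L \<subseteq># A"
        and R: "set_mset R \<subseteq> verts E" for L R
    proof -
      obtain A' where A: "A = L + A'"
        using L by (auto simp: mset_subset_eq_exists_conv)
      then have A': "set_mset A' \<subseteq> verts E"
        using less.prems by auto
      then have equ': "(A, R + A') \<in> config_equiv"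
        using config_equiv_add[OF equ config_equiv_refl] A by simp
      have "W (R + A') < W A"
        using W by (simp add: W_def A)
      moreover have "set_mset (R + A') \<subseteq> verts E"
        using R A' by simp
      ultimately obtain B where "set_mset B \<subseteq> verts E" "stable B" "(R + A', B) \<in> config_equiv"
        using less.hyps by blast
      then show ?case
        using equ' config_equiv_trans by blast
    qed
    consider "s \<in># A" | v where "v \<in> verts E - {s}" "out_degree E v \<le> count A v" | "stable A"
      unfolding stable_def by (meson not_less)
    then show ?case
    proof cases
      case 1
      then show ?thesis
        using pos by (intro reduce[OF config_equiv_sink]) (auto simp: W_def)
    next
      case (2 v)
      have "(\<Sum>e\<in>#mset_set (out_arcs E v). w (head E e)) = (\<Sum>e\<in>out_arcs E v. w (head E e))"
        by (simp add: sum_unfold_sum_mset)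
      then have "W (image_mset (head E) (mset_set (out_arcs E v))) < W (replicate_mset (out_degree E v) v)"
        using topple[OF 2(1)]
        by (simp add: W_def image_mset.compositionality comp_def)
      then show ?thesis
        using 2 finite_out_arcs[of v]
        by (intro reduce[OF config_equiv_topple]) (auto simp: count_le_replicate_mset_subset_eq)
    next
      case 3
      then show ?thesis
        using less.prems config_equiv_refl by blast
    qed
  qed
qed

text \<open>The total number of chips is bounded by the sum of all out-degrees, so stable
  configurations come from lists of bounded length.\<close>

lemma finite_stable: "finite {A. set_mset A \<subseteq> verts E \<and> stable A}"
proof (rule finite_subset)
  let ?N = "\<Sum>v\<in>verts E. out_degree E v"
  show "finite (mset ` {xs. set xs \<subseteq> verts E \<and> length xs \<le> ?N})"
    by (intro finite_imageI finite_lists_length_le) simp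
  show "{A. set_mset A \<subseteq> verts E \<and> stable A} \<subseteq> mset ` {xs. set xs \<subseteq> verts E \<and> length xs \<le> ?N}"
  proof
    fix A assume "A \<in> {A. set_mset A \<subseteq> verts E \<and> stable A}"
    then have A: "set_mset A \<subseteq> verts E" "stable A"
      by auto
    have "size A = (\<Sum>v\<in>set_mset A. count A v)"
      by (simp add: size_multiset_overloaded_eq)
    also have "\<dots> \<le> (\<Sum>v\<in>set_mset A. out_degree E v)"
      using A by (intro sum_mono) (auto simp: stable_def intro: less_imp_le)
    also have "\<dots> \<le> ?N"
      using A(1) by (intro sum_mono2) auto
    finally have "size A \<le> ?N" .
    moreover obtain xs where "A = mset xs"
      by (metis ex_mset)
    ultimately show "A \<in> mset ` {xs. set xs \<subseteq> verts E \<and> length xs \<le> ?N}"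
      using A(1) by auto
  qed
qed

lemma finite_SP: "finite (carrier (SP E s))"
proof (rule finite_subset)
  show "carrier (SP E s) \<subseteq> config_class ` {A. set_mset A \<subseteq> verts E \<and> stable A}"
  proof
    fix x assume "x \<in> carrier (SP E s)"
    then obtain A where A: "set_mset A \<subseteq> verts E" "x = config_class A"
      by (auto simp: SP_carrier)
    obtain B where B: "set_mset B \<subseteq> verts E" "stable B" "(A, B) \<in> config_equiv"
      using stabilisation[OF A(1)] by blast
    then have "x = config_class B"
      using A config_class_eq_iff by simp
    then show "x \<in> config_class ` {A. set_mset A \<subseteq> verts E \<and> stable A}"
      using B by blast
  qed
qed (simp add: finite_stable)

section \<open>Order-ideals and hereditary saturated sets\<close>

definition ideal_vertices :: "'v multiset set set \<Rightarrow> 'v set" where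
  "ideal_vertices I = {v \<in> verts E. config_class {#v#} \<in> I}"

lemma order_ideal_mult_iff:
  assumes "order_ideal M I" "x \<in> carrier M" "y \<in> carrier M"
  shows "x \<otimes>\<^bsub>M\<^esub> y \<in> I \<longleftrightarrow> x \<in> I \<and> y \<in> I"
  using assms submonoid.m_closed unfolding order_ideal_def by metis

text \<open>An order-ideal contains a product exactly when it contains both factors, so membership
  of a class can be tested chip by chip.\<close>

lemma config_class_in_order_ideal_iff:
  assumes I: "order_ideal (SP E s) I"
  shows "set_mset A \<subseteq> verts E \<Longrightarrow> config_class A \<in> I \<longleftrightarrow> set_mset A \<subseteq> ideal_vertices I"
proof (induction A)
  case empty
  have "\<one>\<^bsub>SP E s\<^esub> \<in> I"
    using I submonoid.one_closed by (auto simp: order_ideal_def)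
  then show ?case
    by (simp add: SP_one)
next
  case (add v A)
  then have "config_class (add_mset v A) = config_class {#v#} \<otimes>\<^bsub>SP E s\<^esub> config_class A"
    by (subst SP_mult) auto
  then have "config_class (add_mset v A) \<in> I \<longleftrightarrow> config_class {#v#} \<in> I \<and> config_class A \<in> I"
    using add.prems order_ideal_mult_iff[OF I] by (simp add: config_class_in_SP)
  then show ?case
    using add by (auto simp: ideal_vertices_def)
qed

lemma ideal_vertices_hereditary_saturated:
  assumes I: "order_ideal (SP E s) I"
  shows "hereditary E (ideal_vertices I)" "saturated E (ideal_vertices I)"
proof -
  have sub: "ideal_vertices I \<subseteq> verts E"
    by (auto simp: ideal_vertices_def)
  \<comment> \<open>The two sides of the toppling relation at \<open>v\<close> have the same class,
    so their supports lie in the set together. Left to right this is heredity, right to left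
    saturation.\<close>
  have iff: "v \<in> ideal_vertices I \<longleftrightarrow> head E ` out_arcs E v \<subseteq> ideal_vertices I"
    if v: "v \<in> verts E - {s}" for v
  proof -
    let ?R = "image_mset (head E) (mset_set (out_arcs E v))"
    let ?L = "replicate_mset (out_degree E v) v"
    have R: "set_mset ?R = head E ` out_arcs E v"
      using finite_out_arcs[of v] by simp
    \<comment> \<open>The out-degree is nonzero; otherwise the left side would be empty and say
      nothing about \<open>v\<close>.\<close>
    have L: "set_mset ?L = {v}"
      using out_arcs_nonempty[OF v] finite_out_arcs[of v] by (auto simp: out_degree_def)
    have "set_mset ?L \<subseteq> verts E" "set_mset ?R \<subseteq> verts E"
      using v unfolding L R by auto
    then have "set_mset ?L \<subseteq> ideal_vertices I \<longleftrightarrow> set_mset ?R \<subseteq> ideal_vertices I"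
      using config_equiv_topple[OF v] config_class_eq_iff config_class_in_order_ideal_iff[OF I]
      by metis
    then show ?thesis
      unfolding L R by simp
  qed
  show "hereditary E (ideal_vertices I)"
    unfolding hereditary_def
  proof (intro conjI ballI impI sub)
    fix e assume e: "e \<in> arcs E" "tail E e \<in> ideal_vertices I"
    have "tail E e \<noteq> s"
      using e(1) is_sink_iff[of s] by (auto simp: is_sink_def)
    then show "head E e \<in> ideal_vertices I"
      using iff[of "tail E e"] e by auto
  qed
  show "saturated E (ideal_vertices I)"
    unfolding saturated_def regular_vertex_def using iff sub by (auto simp: is_sink_iff)
qed

lemma config_equiv_hereditary_saturated:
  assumes H: "hereditary E H" "saturated E H" "s \<in> H" and AB: "(A, B) \<in> config_equiv"
  shows "set_mset A \<subseteq> H \<longleftrightarrow> set_mset B \<subseteq> H"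
proof -
  let ?F = "free_comm_monoid (verts E)"
  \<comment> \<open>Agreement on support in \<open>H\<close> is a congruence, since the support of a
    sum is a union. It contains the defining relations, hence the congruence they generate.\<close>
  let ?r = "{(A, B). A \<in> carrier ?F \<and> B \<in> carrier ?F \<and> (set_mset A \<subseteq> H \<longleftrightarrow> set_mset B \<subseteq> H)}"
  have "equiv (carrier ?F) ?r"
    by (intro equivI refl_onI symI transI) auto
  then have "monoid_congruence ?F ?r"
    by (auto simp: monoid_congruence_def free_comm_monoid_def)
  moreover have "sandpile_relations E s \<subseteq> ?r"
  proof
    fix p assume p: "p \<in> sandpile_relations E s"
    show "p \<in> ?r"
    proof (cases "p = ({#s#}, {#})")
      case True
      then show ?thesis
        using H(3) p sandpile_relations_carrier by auto
    next
      case False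
      then obtain v where v: "v \<in> verts E - {s}" and p_eq:
        "p = (replicate_mset (out_degree E v) v, image_mset (head E) (mset_set (out_arcs E v)))"
        using p by (auto simp: sandpile_relations_def)
      have "out_degree E v \<noteq> 0"
        using out_arcs_nonempty[OF v] finite_out_arcs[of v] by (simp add: out_degree_def)
      moreover have "v \<in> H \<longleftrightarrow> head E ` out_arcs E v \<subseteq> H"
      proof
        show "v \<in> H" if "head E ` out_arcs E v \<subseteq> H"
          using H(2) v that finite_out_arcs by (auto simp: saturated_def regular_vertex_def is_sink_iff)
      qed (use H(1) in \<open>auto simp: hereditary_def\<close>)
      ultimately show ?thesis
        using p sandpile_relations_carrier finite_out_arcs[of v] by (auto simp: p_eq)
    qed
  qed
  ultimately have "config_equiv \<subseteq> ?r"
    unfolding config_equiv_def by (intro hull_minimal)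
  then show ?thesis
    using AB by auto
qed

lemma hereditary_saturated_order_ideal:
  assumes H: "hereditary E H" "saturated E H" "s \<in> H"
  shows "order_ideal (SP E s) (config_class ` {A. set_mset A \<subseteq> H})" (is "order_ideal _ ?I")
    and "ideal_vertices (config_class ` {A. set_mset A \<subseteq> H}) = H"
proof -
  have HE: "H \<subseteq> verts E"
    using H(1) by (auto simp: hereditary_def)
  \<comment> \<open>Invariance of the support condition makes membership independent of the
    representative.\<close>
  have mem: "config_class A \<in> ?I \<longleftrightarrow> set_mset A \<subseteq> H" if A: "set_mset A \<subseteq> verts E" for A
  proof
    assume "config_class A \<in> ?I"
    then obtain B where B: "set_mset B \<subseteq> H" "config_class A = config_class B"
      by auto
    then have "(A, B) \<in> config_equiv"
      using config_class_eq_iff[OF A, of B] HE by auto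
    then show "set_mset A \<subseteq> H"
      using config_equiv_hereditary_saturated[OF H] B(1) by blast
  qed auto
  show "ideal_vertices ?I = H"
    using HE mem[of "{#_#}"] unfolding ideal_vertices_def by auto
  have "submonoid ?I (SP E s)"
  proof
    show "?I \<subseteq> carrier (SP E s)"
      using HE by (auto intro: config_class_in_SP)
    show "\<one>\<^bsub>SP E s\<^esub> \<in> ?I"
      by (auto simp: SP_one)
    fix x y assume "x \<in> ?I" "y \<in> ?I"
    then obtain A B where AB: "set_mset A \<subseteq> H" "set_mset B \<subseteq> H" "x = config_class A" "y = config_class B"
      by auto
    then have "x \<otimes>\<^bsub>SP E s\<^esub> y = config_class (A + B)"
      using HE SP_mult[of A B] by simp
    then show "x \<otimes>\<^bsub>SP E s\<^esub> y \<in> ?I"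
      using AB by auto
  qed
  moreover have "x \<in> ?I \<and> y \<in> ?I"
    if xy: "x \<in> carrier (SP E s)" "y \<in> carrier (SP E s)" "x \<otimes>\<^bsub>SP E s\<^esub> y \<in> ?I" for x y
  proof -
    obtain A B where AB: "set_mset A \<subseteq> verts E" "set_mset B \<subseteq> verts E"
      "x = config_class A" "y = config_class B"
      using xy(1,2) by (auto simp: SP_carrier)
    then have "config_class (A + B) \<in> ?I"
      using xy(3) by (simp add: SP_mult)
    then have "set_mset (A + B) \<subseteq> H"
      using AB by (subst (asm) mem) auto
    then show ?thesis
      using AB by auto
  qed
  ultimately show "order_ideal (SP E s) ?I"
    by (auto simp: order_ideal_def)
qed

lemma order_ideal_hereditary_saturated:
  "order_isomorphic (order_ideal_lattice (SP E s)) (hereditary_saturated_lattice E)"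
proof (rule order_isomorphicI[where f = ideal_vertices])
  \<comment> \<open>The relation that kills the sink puts it into every order-ideal, because the
    unit is there; this makes the vertex set nonempty.\<close>
  have "s \<in> ideal_vertices I" if "order_ideal (SP E s) I" for I
    using config_class_in_order_ideal_iff[OF that, of "{#}"] config_equiv_sink
      config_class_eq_iff[of "{#s#}" "{#}"] sink_in_verts
    by (auto simp: ideal_vertices_def)
  then have "ideal_vertices ` {I. order_ideal (SP E s) I} \<subseteq>
      {H. H \<noteq> {} \<and> hereditary E H \<and> saturated E H}"
    using ideal_vertices_hereditary_saturated by blast
  moreover have "H \<in> ideal_vertices ` {I. order_ideal (SP E s) I}"
    if "H \<noteq> {}" "hereditary E H" "saturated E H" for H
    using hereditary_saturated_order_ideal[OF that(2,3) sink_in_hereditary[OF that(2,1)]]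
    by (intro image_eqI[where x = "config_class ` {A. set_mset A \<subseteq> H}"]) simp_all
  ultimately show "ideal_vertices ` carrier (order_ideal_lattice (SP E s))
      = carrier (hereditary_saturated_lattice E)"
    unfolding order_ideal_lattice_def hereditary_saturated_lattice_def inclusion_order_simps by blast
  fix I J assume "I \<in> carrier (order_ideal_lattice (SP E s))" "J \<in> carrier (order_ideal_lattice (SP E s))"
  then have IJ: "order_ideal (SP E s) I" "order_ideal (SP E s) J"
    by (simp_all add: order_ideal_lattice_def)
  have "I \<subseteq> J" if sub: "ideal_vertices I \<subseteq> ideal_vertices J"
  proof
    fix x assume x: "x \<in> I"
    then have "x \<in> carrier (SP E s)"
      using IJ(1) submonoid.subset by (auto simp: order_ideal_def)
    then obtain A where "set_mset A \<subseteq> verts E" "x = config_class A"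
      by (auto simp: SP_carrier)
    then show "x \<in> J"
      using x sub config_class_in_order_ideal_iff[OF IJ(1)] config_class_in_order_ideal_iff[OF IJ(2)]
      by blast
  qed
  then show "ideal_vertices I \<sqsubseteq>\<^bsub>hereditary_saturated_lattice E\<^esub> ideal_vertices J
      \<longleftrightarrow> I \<sqsubseteq>\<^bsub>order_ideal_lattice (SP E s)\<^esub> J"
    by (auto simp: order_ideal_lattice_def hereditary_saturated_lattice_def ideal_vertices_def)
qed (auto simp: order_ideal_lattice_def)

end

section \<open>Comparison of the five lattices through the lattice of filters\<close>

theorem theorem3p6:
  fixes E :: "('v, 'e) pre_digraph" and s :: 'v
  assumes "sandpile_graph E s"
  shows
    "lattice_isomorphic (Idem_lattice (SP E s)) (filter_lattice E) \<and>
     lattice_isomorphic (Idem_lattice (SP E s)) (hereditary_saturated_lattice E) \<and>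
     lattice_isomorphic (Idem_lattice (SP E s)) (Hs_ideal_lattice E) \<and>
     lattice_isomorphic (Idem_lattice (SP E s)) (order_ideal_lattice (SP E s)) \<and>
     lattice_isomorphic (filter_lattice E) (hereditary_saturated_lattice E) \<and>
     lattice_isomorphic (filter_lattice E) (Hs_ideal_lattice E) \<and>
     lattice_isomorphic (filter_lattice E) (order_ideal_lattice (SP E s)) \<and>
     lattice_isomorphic (hereditary_saturated_lattice E) (Hs_ideal_lattice E) \<and>
     lattice_isomorphic (hereditary_saturated_lattice E) (order_ideal_lattice (SP E s)) \<and>
     lattice_isomorphic (Hs_ideal_lattice E) (order_ideal_lattice (SP E s))"
proof -
  interpret sandpile_graph E s
    by fact
  have H: "order_isomorphic (filter_lattice E) (hereditary_saturated_lattice E)"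
    by (rule filter_lattice_hereditary_saturated)
  have L: "order_isomorphic (filter_lattice E) (order_ideal_lattice (SP E s))"
    using H order_ideal_hereditary_saturated order_isomorphic_sym order_isomorphic_trans by blast
  have I: "order_isomorphic (filter_lattice E) (Idem_lattice (SP E s))"
    using L Idem_lattice_order_isomorphic[OF comm_monoid_SP finite_SP]
      order_isomorphic_sym order_isomorphic_trans by blast
  \<comment> \<open>The hub is also an endpoint of some pairs; its isomorphism to itself is
    \<open>H\<close> followed by its inverse.\<close>
  have F: "order_isomorphic (filter_lattice E) (filter_lattice E)"
    using H order_isomorphic_sym order_isomorphic_trans by blast
  have eqs: "eq (filter_lattice E) = (=)" "eq (hereditary_saturated_lattice E) = (=)"
    "eq (order_ideal_lattice (SP E s)) = (=)" "eq (Idem_lattice (SP E s)) = (=)"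
    "eq (Hs_ideal_lattice E) = (=)"
    by (simp_all add: filter_lattice_def hereditary_saturated_lattice_def order_ideal_lattice_def
        Idem_lattice_def Hs_ideal_lattice_def)
  note iso = order_isomorphic_imp_lattice_isomorphic[OF _ _ lattice_filter_lattice[of E]]
  show ?thesis
    by (intro conjI iso H L I F filter_lattice_Hs_ideal eqs)
qed

end
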